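(* Let $\alpha\ge0$ and let $T$ be a $(C,\alpha)$-bounded operator on a complex Banach space $X$ with $\overline{\operatorname{Ran}}(I-T)=X$. Given $x\in X$ the following are equivalent: (i) $x\in\operatorname{Dom}(\log(I-T))$. (ii) The series $\sum_{n=1}^\infty\frac{1}{n^{1+\alpha}}\Delta^{-\alpha}\mathcal T(n)x$ converges in norm (or, equivalently, converges weakly). Furthermore, if (i) or (ii) holds, then $$\log(I-T)x=\left(\int_0^1\frac{1-u^\alpha}{1-u}\,du\right)x-\sum_{n=1}^\infty\frac{\Gamma(\alpha+1)\Gamma(n)}{\Gamma(n+\alpha+1)}\Delta^{-\alpha}\mathcal T(n)x.$$
   Context: For $\alpha\in\mathbb R$: $k^\alpha(0)=1$, $k^\alpha(n)=\frac{\alpha(\alpha+1)\cdots(\alpha+n-1)}{n!}$ for $n\ge1$. For $T\in\mathcal B(X)$: $\Delta^{-\alpha}\mathcal T(n)=\sum_{j=0}^nk^\alpha(n-j)T^j$, and $T$ is $(C,\alpha)$-bounded if $\sup_n\|\Delta^{-\alpha}\mathcal T(n)\|/k^{\alpha+1}(n)<\infty$. Put $D^\alpha f(n)=\sum_{j=n}^\infty k^{-\alpha}(j-n)f(j)$ and $W^{-\alpha}f(n)=\sum_{j=n}^\infty k^{\alpha}(j-n)f(j)$. $A^\alpha(\mathbb D)$ is the Banach algebra of functions $\mathfrak h(z)=\sum h(n)z^n$ with $h\in\ell^1$, $h=W^{-\alpha}u$ for some (unique, equal to $D^\alpha h$) sequence $u$ with $\sum_n|u(n)|k^{\alpha+1}(n)<\infty$.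 For $T$ $(C,\alpha)$-bounded and $\mathfrak h\in A^\alpha(\mathbb D)$, $\mathfrak h(T):=\sum_{n\ge0}D^\alpha h(n)\Delta^{-\alpha}\mathcal T(n)\in\mathcal B(X)$, a bounded algebra homomorphism. Under the hypotheses $I-T$ is injective, $(1-z)\log(1-z)\in A^\alpha(\mathbb D)$, and $\log(I-T)$ is the closed operator $\log(I-T):=(I-T)^{-1}\,[(1-z)\log(1-z)](T)$, with domain $\{x\in X:[(1-z)\log(1-z)](T)x\in\operatorname{Ran}(I-T)\}$. (It is also the infinitesimal generator of the holomorphic $C_0$-semigroup $((I-T)^s)_{\mathrm{Re}\,s>0}$ given by the functional calculus.) *)

theory Defs
  imports "HOL-Complex_Analysis.Complex_Analysis"
begin

class complex_normed_vector = real_normed_vector +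
  fixes scaleC :: "complex \<Rightarrow> 'a \<Rightarrow> 'a"  (infixr \<open>*\<^sub>C\<close> 75)
  assumes scaleC_add_right: "a *\<^sub>C (x + y) = a *\<^sub>C x + a *\<^sub>C y"
    and scaleC_add_left: "(a + b) *\<^sub>C x = a *\<^sub>C x + b *\<^sub>C x"
    and scaleC_scaleC: "a *\<^sub>C b *\<^sub>C x = (a * b) *\<^sub>C x"
    and scaleC_one: "1 *\<^sub>C x = x"
    and scaleC_of_real: "complex_of_real r *\<^sub>C x = r *\<^sub>R x"
    and norm_scaleC: "norm (a *\<^sub>C x) = cmod a * norm x"

class cbanach = complex_normed_vector + banach

instantiation complex :: complex_normed_vector
begin

definition scaleC_complex :: "complex \<Rightarrow> complex \<Rightarrow> complex" where
  "scaleC_complex a z = a * z"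

instance
  by standard (simp_all add: scaleC_complex_def algebra_simps norm_mult scaleR_conv_of_real)

end

lemma bounded_linear_scaleC: "bounded_linear (\<lambda>x::'a::complex_normed_vector. a *\<^sub>C x)"
proof (rule bounded_linear_intro)
  show "a *\<^sub>C (x + y) = a *\<^sub>C x + a *\<^sub>C y" for x y :: 'a
    by (rule scaleC_add_right)
  show "a *\<^sub>C r *\<^sub>R x = r *\<^sub>R a *\<^sub>C x" for r and x :: 'a
    by (simp add: scaleC_scaleC mult.commute flip: scaleC_of_real)
  show "norm (a *\<^sub>C x) \<le> norm x * cmod a" for x :: 'a
    by (simp add: norm_scaleC mult.commute)
qed

instantiation blinfun :: (real_normed_vector, complex_normed_vector) complex_normed_vector
begin

lift_definition scaleC_blinfun :: "complex \<Rightarrow> 'a \<Rightarrow>\<^sub>L 'b \<Rightarrow> 'a \<Rightarrow>\<^sub>L 'b"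
  is "\<lambda>a f x. a *\<^sub>C f x"
  by (rule bounded_linear_compose[OF bounded_linear_scaleC])

instance
proof
  fix a b :: complex and r :: real and f g :: "'a \<Rightarrow>\<^sub>L 'b"
  show "a *\<^sub>C (f + g) = a *\<^sub>C f + a *\<^sub>C g"
    by transfer (simp add: scaleC_add_right)
  show "(a + b) *\<^sub>C f = a *\<^sub>C f + b *\<^sub>C f"
    by transfer (simp add: scaleC_add_left)
  show "a *\<^sub>C b *\<^sub>C f = (a * b) *\<^sub>C f"
    by transfer (simp add: scaleC_scaleC)
  show "1 *\<^sub>C f = f"
    by transfer (simp add: scaleC_one)
  show "complex_of_real r *\<^sub>C f = r *\<^sub>R f"
    by transfer (simp add: scaleC_of_real)
  show "norm (a *\<^sub>C f) = cmod a * norm f"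
  proof (rule antisym)
    have le: "norm (c *\<^sub>C h) \<le> cmod c * norm h" for c and h :: "'a \<Rightarrow>\<^sub>L 'b"
    proof (rule norm_blinfun_bound)
      show "norm (blinfun_apply (c *\<^sub>C h) x) \<le> cmod c * norm h * norm x" for x
        by (simp add: scaleC_blinfun.rep_eq norm_scaleC mult.assoc mult_left_mono norm_blinfun)
    qed simp
    show "norm (a *\<^sub>C f) \<le> cmod a * norm f"
      by (rule le)
    show "cmod a * norm f \<le> norm (a *\<^sub>C f)"
    proof (cases "a = 0")
      case False
      have "f = inverse a *\<^sub>C a *\<^sub>C f"
        using False by transfer (simp add: scaleC_scaleC scaleC_one)
      then have "norm f \<le> cmod (inverse a) * norm (a *\<^sub>C f)"
        using le by metis
      then show ?thesis
        using False by (simp add: norm_divide field_simps)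
    qed simp
  qed
qed

end

text \<open>
  The type \<open>'a \<Rightarrow>\<^sub>L 'b\<close> consists of real-linear bounded maps; the elements of
  $\mathcal{B}(X)$ and of the dual $X^*$ are those satisfying the following predicate.
\<close>

definition clinear :: "('a::complex_normed_vector \<Rightarrow> 'b::complex_normed_vector) \<Rightarrow> bool" where
  "clinear f \<longleftrightarrow> Vector_Spaces.linear (*\<^sub>C) (*\<^sub>C) f"

definition weakly_convergent :: "(nat \<Rightarrow> 'a::complex_normed_vector) \<Rightarrow> bool" where
  "weakly_convergent X \<longleftrightarrow>
     (\<exists>l. \<forall>\<phi> :: 'a \<Rightarrow>\<^sub>L complex. clinear \<phi> \<longrightarrow> (\<lambda>N. \<phi> (X N)) \<longlonglongrightarrow> \<phi> l)"

definition cesaro_kernel :: "real \<Rightarrow> nat \<Rightarrow> real" where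
  "cesaro_kernel \<alpha> n = pochhammer \<alpha> n / fact n"

definition blinfun_power :: "('a::real_normed_vector \<Rightarrow>\<^sub>L 'a) \<Rightarrow> nat \<Rightarrow> 'a \<Rightarrow>\<^sub>L 'a" where
  "blinfun_power T n = ((o\<^sub>L) T ^^ n) id_blinfun"

definition cesaro_sum :: "real \<Rightarrow> ('a::real_normed_vector \<Rightarrow>\<^sub>L 'a) \<Rightarrow> nat \<Rightarrow> 'a \<Rightarrow>\<^sub>L 'a" where
  "cesaro_sum \<alpha> T n = (\<Sum>j\<le>n. cesaro_kernel \<alpha> (n - j) *\<^sub>R blinfun_power T j)"

definition cesaro_bounded :: "real \<Rightarrow> ('a::real_normed_vector \<Rightarrow>\<^sub>L 'a) \<Rightarrow> bool" where
  "cesaro_bounded \<alpha> T \<longleftrightarrow>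
     bdd_above (range (\<lambda>n. norm (cesaro_sum \<alpha> T n) / cesaro_kernel (\<alpha> + 1) n))"

text \<open>$D^\alpha h(n) = \sum_{j \ge n} k^{-\alpha}(j-n) h(j)$, summed over $i = j - n$.\<close>

definition weyl_difference :: "real \<Rightarrow> (nat \<Rightarrow> complex) \<Rightarrow> nat \<Rightarrow> complex" where
  "weyl_difference \<alpha> h n = (\<Sum>i. complex_of_real (cesaro_kernel (- \<alpha>) i) * h (n + i))"

text \<open>
  The operator $f(T) = \sum_n D^\alpha h(n)\, \Delta^{-\alpha}\mathcal{T}(n)$, where $h$ is the
  sequence of Taylor coefficients of $f$ at $0$ and the series is taken in operator norm. It is
  meaningful for $f \in A^\alpha(\mathbb{D})$ and $(C,\alpha)$-bounded $T$, where the series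
  converges absolutely.
\<close>

definition cesaro_calculus ::
    "real \<Rightarrow> (complex \<Rightarrow> complex) \<Rightarrow> ('a::cbanach \<Rightarrow>\<^sub>L 'a) \<Rightarrow> 'a \<Rightarrow>\<^sub>L 'a" where
  "cesaro_calculus \<alpha> f T =
     (\<Sum>n. weyl_difference \<alpha> (fps_nth (fps_expansion f 0)) n *\<^sub>C cesaro_sum \<alpha> T n)"

text \<open>
  $\log(I-T) = (I-T)^{-1}\,[(1-z)\log(1-z)](T)$ with its natural domain. The inverse is the
  one on $\operatorname{Ran}(I-T)$ and presupposes that $I-T$ is injective, which is automatic
  for $(C,\alpha)$-bounded $T$ with $\operatorname{Ran}(I-T)$ dense.
\<close>

definition log_domain :: "real \<Rightarrow> ('a::cbanach \<Rightarrow>\<^sub>L 'a) \<Rightarrow> 'a set" where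
  "log_domain \<alpha> T =
     {x. cesaro_calculus \<alpha> (\<lambda>z. (1 - z) * Ln (1 - z)) T x \<in> range (id_blinfun - T)}"

definition log_op :: "real \<Rightarrow> ('a::cbanach \<Rightarrow>\<^sub>L 'a) \<Rightarrow> 'a \<Rightarrow> 'a" where
  "log_op \<alpha> T x =
     inv (id_blinfun - T) (cesaro_calculus \<alpha> (\<lambda>z. (1 - z) * Ln (1 - z)) T x)"

end

theory Submission
  imports Defs "HOL-Real_Asymp.Real_Asymp"
begin

text \<open>
  Write \<open>A = I - T\<close>, \<open>H = [(1 - z) log(1 - z)](T)\<close>, \<open>S\<^sub>n\<close> for the Cesaro sums of order \<open>\<alpha>\<close>,
  \<open>g(n) = \<Gamma>(\<alpha> + 1)\<Gamma>(n)/\<Gamma>(n + \<alpha> + 1)\<close>, \<open>L\<^sub>N = \<Sum>\<^bsub>n\<le>N\<^esub> g(n) S\<^sub>n\<close> and \<open>C\<close> for the integral.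
  Since \<open>g = D\<^sup>\<alpha>(1/n)\<close>, summation by parts gives \<open>A L\<^sub>N = C A - H + O(1/N)\<close> in norm, so a (weak)
  limit \<open>y\<close> of \<open>L\<^sub>N x\<close> satisfies \<open>H x = A (C x - y)\<close>. The weights \<open>g(n)/\<Gamma>(\<alpha> + 1)\<close> and
  \<open>n\<^bsup>-1-\<alpha>\<^esup>\<close> differ by a factor \<open>1 + O(1/n)\<close>, which changes the series by an absolutely convergent one.

  Conversely let \<open>H x = A w\<close> and \<open>v = C x - w\<close>. Another summation by parts replaces \<open>S\<^sub>n\<close> by the means
  \<open>\<sigma>\<^sub>n\<close> of order \<open>\<alpha> + 1\<close> (changing \<open>C\<close> by \<open>1/(\<alpha> + 1)\<close>), and \<open>L\<^sub>N\<close> becomes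
  \<open>\<Sum>\<^bsub>n\<le>N\<^esub> \<sigma>\<^sub>n/n\<close>. These means satisfy \<open>\<parallel>A \<sigma>\<^sub>n\<parallel> = O(1/n)\<close> and \<open>I - \<sigma>\<^sub>n = A Q\<^sub>n\<close> with
  \<open>\<parallel>Q\<^sub>n\<parallel> = O(n)\<close>; as the range of \<open>A\<close> is dense, \<open>\<sigma>\<^sub>n\<close> tends strongly to zero and \<open>A\<close> is injective.
  With harmonic numbers \<open>h\<^sub>N\<close>, the vector \<open>y\<^sub>N = h\<^sub>N \<sigma>\<^sub>N x + v - L\<^sub>N x\<close> equals \<open>B\<^sub>N x - \<sigma>\<^sub>N w\<close> for
  uniformly bounded operators \<open>B\<^sub>N\<close> that tend strongly to zero, so \<open>y\<^sub>N \<longlonglongrightarrow> 0\<close>, and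
  \<open>y\<^sub>N - y\<^bsub>N+1\<^esub> = h\<^sub>N (\<sigma>\<^sub>N - \<sigma>\<^bsub>N+1\<^esub>) x\<close>. Dividing by \<open>h\<^sub>N\<close> and summing by parts yields
  \<open>h\<^sub>N \<sigma>\<^sub>N x \<longlonglongrightarrow> 0\<close>, hence \<open>L\<^sub>N x \<longlonglongrightarrow> v\<close>.
\<close>

subsection \<open>Cesaro kernels and Weyl differences\<close>

lemma cesaro_kernel_0 [simp]: "cesaro_kernel a 0 = 1"
  by (simp add: cesaro_kernel_def)

lemma cesaro_kernel_Suc: "real (Suc n) * cesaro_kernel a (Suc n) = (a + real n) * cesaro_kernel a n"
  by (simp add: cesaro_kernel_def pochhammer_Suc field_simps del: of_nat_Suc)

lemma cesaro_kernel_rec: "real (Suc n) * cesaro_kernel a (Suc n) = a * cesaro_kernel (a + 1) n"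
  by (simp add: cesaro_kernel_def pochhammer_rec field_simps del: of_nat_Suc)

lemma cesaro_kernel_plus1_Suc:
  "cesaro_kernel (a + 1) (Suc n) = cesaro_kernel (a + 1) n + cesaro_kernel a (Suc n)"
proof -
  have "real (Suc n) * cesaro_kernel (a + 1) (Suc n)
      = real (Suc n) * cesaro_kernel (a + 1) n + real (Suc n) * cesaro_kernel a (Suc n)"
    unfolding cesaro_kernel_Suc[of n "a + 1"] cesaro_kernel_rec[of n a] by (simp add: algebra_simps)
  then show ?thesis
    unfolding distrib_left[symmetric] by simp
qed

lemma cesaro_kernel_sum: "(\<Sum>j\<le>n. cesaro_kernel a j) = cesaro_kernel (a + 1) n"
  by (induction n) (simp_all add: cesaro_kernel_plus1_Suc)

lemma cesaro_kernel_pos: "a > 0 \<Longrightarrow> cesaro_kernel a n > 0"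
  by (simp add: cesaro_kernel_def pochhammer_pos)

lemma cesaro_kernel_zero_Suc: "cesaro_kernel 0 (Suc n) = 0"
  by (simp add: cesaro_kernel_def pochhammer_0_left)

text \<open>Beyond \<open>a\<close> the products of the index and the absolute kernel decrease, with
  decrements \<open>a\<close> times the absolute kernel, so the series telescopes. For
  \<open>a = 0\<close> the decrements vanish, hence the separate case.\<close>

lemma summable_abs_cesaro_kernel_neg:
  assumes "a \<ge> 0"
  shows "summable (\<lambda>i. \<bar>cesaro_kernel (- a) i\<bar>)"
proof (cases "a = 0")
  case True
  have "summable (\<lambda>i. \<bar>cesaro_kernel 0 (Suc i)\<bar>)" by (simp add: cesaro_kernel_zero_Suc)
  then show ?thesis using True by (simp only: minus_zero) (subst (asm) summable_Suc_iff)
next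
  case False
  then have a: "a > 0" using assms by simp
  define m where "m = nat \<lceil>a\<rceil>"
  define f where "f i = real (i + m) * \<bar>cesaro_kernel (- a) (i + m)\<bar>" for i
  have f: "f i - f (Suc i) = a * \<bar>cesaro_kernel (- a) (i + m)\<bar>" for i
  proof -
    have "real (i + m) \<ge> a" unfolding m_def by linarith
    then have "f (Suc i) = (real (i + m) - a) * \<bar>cesaro_kernel (- a) (i + m)\<bar>"
      using arg_cong[OF cesaro_kernel_Suc[of "i + m" "- a"], of abs]
      by (simp add: f_def abs_mult)
    then show ?thesis by (simp add: f_def algebra_simps)
  qed
  have "decseq f"
    using f a by (intro decseq_SucI) (metis abs_ge_zero diff_ge_0_iff_ge mult_nonneg_nonneg less_imp_le)
  moreover have "f i \<ge> 0" for i by (simp add: f_def)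
  ultimately obtain l where "f \<longlonglongrightarrow> l" using decseq_convergent[of f 0] by blast
  then have "(\<lambda>i. f i - f (Suc i)) sums (f 0 - l)" by (rule telescope_sums')
  then have "summable (\<lambda>i. a * \<bar>cesaro_kernel (- a) (i + m)\<bar>)"
    by (simp add: f sums_iff)
  then have "summable (\<lambda>i. \<bar>cesaro_kernel (- a) (i + m)\<bar>)"
    using a by (simp add: summable_cmult_iff)
  then show ?thesis by (subst (asm) summable_iff_shift)
qed

lemma cesaro_kernel_neg_tendsto_0: "a \<ge> 0 \<Longrightarrow> cesaro_kernel (- a) \<longlonglongrightarrow> 0"
  using summable_LIMSEQ_zero[OF summable_rabs_cancel[OF summable_abs_cesaro_kernel_neg]] .

lemma summable_cesaro_kernel_neg_over:
  assumes "a \<ge> 0"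
  shows "summable (\<lambda>i. cesaro_kernel (- a) i / real (n + i))"
proof (rule summable_comparison_test'[OF summable_abs_cesaro_kernel_neg[OF assms]])
  show "norm (cesaro_kernel (- a) i / real (n + i)) \<le> \<bar>cesaro_kernel (- a) i\<bar>" if "i \<ge> 0" for i
    by (cases "n + i = 0") (auto simp: abs_div divide_le_eq mult_le_cancel_left1)
qed

text \<open>The Weyl difference \<open>D\<^sup>a\<close> of \<open>n \<mapsto> 1/n\<close>; at \<open>n = 0\<close> the convention \<open>1/0 = 0\<close> drops the first term.\<close>

definition weyl_inverse :: "real \<Rightarrow> nat \<Rightarrow> real" where
  "weyl_inverse a n = (\<Sum>i. cesaro_kernel (- a) i / real (n + i))"

lemma weyl_inverse_sums:
  "a \<ge> 0 \<Longrightarrow> (\<lambda>i. cesaro_kernel (- a) i / real (n + i)) sums weyl_inverse a n"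
  unfolding weyl_inverse_def by (intro summable_sums summable_cesaro_kernel_neg_over)

text \<open>Up to a constant factor the terms are the kernel of order \<open>- (a + 1)\<close>
  shifted by one. Its partial sums are the kernel of order \<open>- a\<close>, which tends to zero,
  so without its first term 1 it sums to -1.\<close>

lemma weyl_inverse_1:
  assumes "a \<ge> 0"
  shows "weyl_inverse a 1 = 1 / (a + 1)"
proof -
  have "cesaro_kernel (- a) i / real (1 + i) = (- 1 / (a + 1)) * cesaro_kernel (- (a + 1)) (Suc i)" for i
    using cesaro_kernel_rec[of i "- (a + 1)"] assms by (simp add: field_simps)
  moreover have "(\<lambda>i. cesaro_kernel (- (a + 1)) (Suc i)) sums (- 1)"
  proof -
    have "(\<lambda>n. \<Sum>i<n. cesaro_kernel (- (a + 1)) i) \<longlonglongrightarrow> 0"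
    proof (rule LIMSEQ_imp_Suc)
      show "(\<lambda>n. \<Sum>i<Suc n. cesaro_kernel (- (a + 1)) i) \<longlonglongrightarrow> 0"
        unfolding lessThan_Suc_atMost cesaro_kernel_sum
        using cesaro_kernel_neg_tendsto_0[OF assms] by simp
    qed
    then have "cesaro_kernel (- (a + 1)) sums 0" by (simp add: sums_def)
    then show ?thesis by (subst sums_Suc_iff) simp
  qed
  ultimately have "(\<lambda>i. cesaro_kernel (- a) i / real (1 + i)) sums ((- 1 / (a + 1)) * - 1)"
    by (simp only: sums_mult)
  then show ?thesis
    unfolding weyl_inverse_def by (simp add: sums_iff)
qed

text \<open>The difference of the two sides, taken termwise, telescopes in \<open>u\<close>, which
  vanishes at 0 and at infinity. Iterating this ratio from \<open>n = 1\<close> gives the closed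
  form of \<open>weyl_inverse\<close>.\<close>

lemma weyl_inverse_Suc:
  assumes "a \<ge> 0" "n \<ge> 1"
  shows "(real n + a + 1) * weyl_inverse a (Suc n) = real n * weyl_inverse a n"
proof -
  define k where "k = cesaro_kernel (- a)"
  define u where "u i = real i * k i / real (n + i)" for i
  have k: "real (Suc i) * k (Suc i) = (real i - a) * k i" for i
    using cesaro_kernel_Suc[of i "- a"] by (simp add: k_def)
  have "u \<longlonglongrightarrow> 0"
  proof (rule Lim_null_comparison)
    show "(\<lambda>i. \<bar>k i\<bar>) \<longlonglongrightarrow> 0"
      using cesaro_kernel_neg_tendsto_0[OF assms(1)] unfolding k_def by (rule tendsto_rabs_zero)
    show "\<forall>\<^sub>F i in sequentially. norm (u i) \<le> \<bar>k i\<bar>"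
      using assms(2) by (auto simp: u_def abs_div abs_mult divide_le_eq algebra_simps)
  qed
  from telescope_sums'[OF this] have "(\<lambda>i. u i - u (Suc i)) sums 0" by (simp add: u_def)
  moreover have "u i - u (Suc i) = (real n + a + 1) * (k i / real (Suc n + i)) - real n * (k i / real (n + i))" for i
  proof -
    have "u (Suc i) = k i * ((real i - a) / real (Suc n + i))" unfolding u_def k by simp
    also have "(real i - a) / real (Suc n + i) = 1 - (real n + a + 1) / real (Suc n + i)"
      by (simp add: field_simps)
    finally have "u (Suc i) = k i - (real n + a + 1) * (k i / real (Suc n + i))"
      by (simp add: right_diff_distrib)
    moreover have "u i = k i - real n * (k i / real (n + i))"
      using assms(2) by (simp add: u_def field_simps)
    ultimately show ?thesis by simp
  qed
  moreover have "(\<lambda>i. (real n + a + 1) * (k i / real (Suc n + i)) - real n * (k i / real (n + i)))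
      sums ((real n + a + 1) * weyl_inverse a (Suc n) - real n * weyl_inverse a n)"
    unfolding k_def by (intro sums_diff sums_mult weyl_inverse_sums assms)
  ultimately show ?thesis
    by (simp only:) (drule (1) sums_unique2, simp)
qed

lemma weyl_inverse_eq:
  assumes "a \<ge> 0" "n \<ge> 1"
  shows "weyl_inverse a n = 1 / (real n * cesaro_kernel (a + 1) n)"
  using assms(2)
proof (induction n rule: dec_induct)
  case base
  then show ?case using weyl_inverse_1[OF assms(1)] by (simp add: cesaro_kernel_def)
next
  case (step n)
  have "(real n + a + 1) * weyl_inverse a (Suc n) = 1 / cesaro_kernel (a + 1) n"
    using weyl_inverse_Suc[OF assms(1) step(1)] step by simp
  moreover have "real (Suc n) * cesaro_kernel (a + 1) (Suc n) = (real n + a + 1) * cesaro_kernel (a + 1) n"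
    using cesaro_kernel_Suc[of n "a + 1"] by (simp add: algebra_simps)
  moreover have "cesaro_kernel (a + 1) n > 0" using assms by (intro cesaro_kernel_pos) simp
  ultimately show ?case
    using assms(1) by (simp add: eq_divide_eq mult.commute mult.left_commute del: of_nat_Suc)
qed

lemma weyl_inverse_Gamma:
  assumes "a \<ge> 0" "n \<ge> 1"
  shows "weyl_inverse a n = Gamma (a + 1) * Gamma (real n) / Gamma (real n + a + 1)"
proof -
  have "pochhammer (a + 1) n = Gamma (a + 1 + real n) / Gamma (a + 1)"
    using assms by (intro pochhammer_Gamma) (auto elim!: nonpos_Ints_cases)
  moreover have "fact n = real n * Gamma (real n)"
    using Gamma_fact[of "n - 1", where 'a = real] assms(2) fact_reduce[of n, where 'a = real]
    by (simp add: of_nat_diff)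
  moreover have "Gamma (a + 1 + real n) > 0" "Gamma (a + 1) > 0"
    using assms by (auto intro!: Gamma_real_pos)
  ultimately show ?thesis
    unfolding weyl_inverse_eq[OF assms] cesaro_kernel_def
    using assms by (simp add: field_simps)
qed

text \<open>The binomial series in powers of \<open>1 - u\<close> turns the integrand into
  \<open>f\<close>. Since the kernel is absolutely summable, the M-test permits termwise
  integration, and the power \<open>i\<close> contributes \<open>1 / Suc i\<close>.\<close>

lemma weyl_inverse_0:
  assumes "a \<ge> 0"
  shows "weyl_inverse a 0 = - integral {0..1} (\<lambda>u. (1 - u powr a) / (1 - u))"
proof -
  define k where "k = cesaro_kernel (- a)"
  define F where "F n u = (\<Sum>i<n. - k (Suc i) * (1 - u) ^ i)" for n and u :: real
  define f where "f u = (\<Sum>i. - k (Suc i) * (1 - u) ^ i)" for u :: real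
  have abs: "summable (\<lambda>i. \<bar>k (Suc i)\<bar>)"
    unfolding k_def using summable_abs_cesaro_kernel_neg[OF assms] by (subst summable_Suc_iff)
  have "uniform_limit {0..1} F f sequentially"
    unfolding F_def f_def
  proof (rule Weierstrass_m_test[OF _ abs])
    fix n and u :: real assume "u \<in> {0..1}"
    then have "\<bar>1 - u\<bar> ^ n \<le> 1" by (intro power_le_one) auto
    then show "norm (- k (Suc n) * (1 - u) ^ n) \<le> \<bar>k (Suc n)\<bar>"
      by (simp add: abs_mult power_abs mult_left_le)
  qed
  moreover have "continuous_on {0..1} (F n)" for n unfolding F_def by (intro continuous_intros)
  ultimately obtain I J where I: "\<And>n. (F n has_integral I n) {0..1}" and J: "(f has_integral J) {0..1}"
    and IJ: "I \<longlonglongrightarrow> J"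
    using uniform_limit_integral trivial_limit_sequentially by metis
  have I_eq: "I = (\<lambda>n. \<Sum>i<n. - k (Suc i) / real (Suc i))"
  proof -
    have "((\<lambda>u::real. (1 - u) ^ i) has_integral (1 / real (Suc i))) {0..1}" for i
    proof -
      have "((\<lambda>u::real. (1 - u) ^ i) has_integral (- ((1 - 1) ^ Suc i / real (Suc i)) - (- ((1 - 0) ^ Suc i / real (Suc i))))) {0..1}"
      proof (rule fundamental_theorem_of_calculus)
        show "((\<lambda>u. - ((1 - u) ^ Suc i / real (Suc i))) has_vector_derivative (1 - u) ^ i) (at u within {0..1})" for u :: real
          unfolding has_real_derivative_iff_has_vector_derivative[symmetric]
          by (rule derivative_eq_intros refl | simp del: of_nat_Suc power_Suc)+
      qed simp
      then show ?thesis by simp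
    qed
    then have "(F n has_integral (\<Sum>i<n. - k (Suc i) * (1 / real (Suc i)))) {0..1}" for n
      unfolding F_def by (intro has_integral_sum has_integral_mult_right) auto
    from has_integral_unique[OF I this] have "I n = (\<Sum>i<n. - k (Suc i) / real (Suc i))" for n by simp
    then show ?thesis by (rule ext)
  qed
  have "(\<lambda>i. - k (Suc i) / real (Suc i)) sums (- weyl_inverse a 0)"
  proof -
    have "(\<lambda>i. k (Suc i) / real (Suc i)) sums weyl_inverse a 0"
      using weyl_inverse_sums[OF assms, of 0] unfolding k_def by (subst sums_Suc_iff) simp
    from sums_minus[OF this] show ?thesis by simp
  qed
  then have "J = - weyl_inverse a 0"
    using IJ unfolding I_eq sums_def by (metis LIMSEQ_unique)
  moreover have "integral {0..1} (\<lambda>u. (1 - u powr a) / (1 - u)) = integral {0..1} f"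
  \<comment> \<open>At \<open>u = 1\<close> the quotient is 0 by the division convention while
    \<open>f\<close> has the value \<open>a\<close>, and \<open>u = 0\<close> lies outside the open
    disc of the binomial series; two points do not affect the integral.\<close>
  proof (rule integral_spike[of "{0, 1}"])
    fix u :: real assume u: "u \<in> {0..1} - {0, 1}"
    have "(\<lambda>n. (a gchoose n) * (u - 1) ^ n) sums (1 + (u - 1)) powr a"
      using u by (intro gen_binomial_real) auto
    moreover have "(a gchoose n) * (u - 1) ^ n = k n * (1 - u) ^ n" for n
    proof -
      have "(u - 1) ^ n = (-1) ^ n * (1 - u) ^ n"
        by (simp flip: power_mult_distrib)
      moreover have "k n = (-1) ^ n * (a gchoose n)"
        by (simp add: gbinomial_pochhammer k_def cesaro_kernel_def)
      ultimately show ?thesis by (simp add: mult_ac)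
    qed
    ultimately have "(\<lambda>n. k n * (1 - u) ^ n) sums (u powr a)" by simp
    then have "(\<lambda>n. k (Suc n) * (1 - u) ^ Suc n) sums (u powr a - 1)"
      by (subst sums_Suc_iff) (simp add: k_def)
    from sums_mult[OF this, of "- 1 / (1 - u)"]
    have "(\<lambda>n. - 1 / (1 - u) * (k (Suc n) * (1 - u) ^ Suc n)) sums ((1 - u powr a) / (1 - u))"
      by (simp only: times_divide_eq_left mult_minus1 minus_diff_eq)
    moreover have "- 1 / (1 - u) * (k (Suc n) * (1 - u) ^ Suc n) = - k (Suc n) * (1 - u) ^ n" for n
      using u by simp
    ultimately have "(\<lambda>n. - k (Suc n) * (1 - u) ^ n) sums ((1 - u powr a) / (1 - u))"
      by (simp only:)
    then show "f u = (1 - u powr a) / (1 - u)"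
      unfolding f_def by (simp add: sums_iff)
  qed auto
  ultimately show ?thesis using integral_unique[OF J] by simp
qed


section \<open>Taylor coefficients of (1 - z) log(1 - z), their Weyl differences, and kernel
  asymptotics\<close>

lemma fps_expansion_one_minus_times_Ln:
  "fps_nth (fps_expansion (\<lambda>z. (1 - z) * Ln (1 - z)) 0) n
     = (case n of 0 \<Rightarrow> 0 | Suc m \<Rightarrow> of_real (1 / real m - 1 / real (Suc m)))"
proof -
  \<comment> \<open>By the convention \<open>1 / 0 = 0\<close> the coefficient of \<open>G\<close>
    at 0 is 0, and the claimed coefficient at index 1 is -1.\<close>
  define G :: "complex fps" where "G = Abs_fps (\<lambda>n. - 1 / of_nat n)"
  have "(\<lambda>z. Ln (1 - z)) has_fps_expansion G"
  proof (rule has_fps_expansionI)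
    have "eventually (\<lambda>z::complex. z \<in> ball 0 1) (nhds 0)"
      by (intro eventually_nhds_in_open) auto
    then show "\<forall>\<^sub>F z in nhds 0. (\<lambda>n. fps_nth G n * z ^ n) sums Ln (1 - z)"
    proof eventually_elim
      case (elim z)
      then show ?case using Ln_series'[of "- z"] by (simp add: G_def field_simps)
    qed
  qed
  then have "(\<lambda>z. (1 - z) * Ln (1 - z)) has_fps_expansion (1 - fps_X) * G"
    by (intro fps_expansion_intros)
  then have eq: "fps_expansion (\<lambda>z. (1 - z) * Ln (1 - z)) 0 = (1 - fps_X) * G"
    by (rule fps_expansion_eqI)
  show ?thesis
    unfolding eq by (cases n) (auto simp: G_def left_diff_distrib)
qed

text \<open>From index 1 on the coefficients are differences of consecutive terms of the sequence
  \<open>1 / n\<close>, and Weyl differences commute with the shift. For \<open>n = 0\<close> the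
  convention \<open>1 / 0 = 0\<close> enters both sides alike.\<close>

lemma weyl_difference_log_Suc:
  assumes "a \<ge> 0"
  shows "weyl_difference a (fps_nth (fps_expansion (\<lambda>z. (1 - z) * Ln (1 - z)) 0)) (Suc n)
    = of_real (weyl_inverse a n - weyl_inverse a (Suc n))"
proof -
  have "(\<lambda>i. cesaro_kernel (- a) i / real (n + i) - cesaro_kernel (- a) i / real (Suc n + i))
      sums (weyl_inverse a n - weyl_inverse a (Suc n))"
    by (intro sums_diff weyl_inverse_sums assms)
  then have "(\<lambda>i. of_real (cesaro_kernel (- a) i) * of_real (1 / real (n + i) - 1 / real (Suc (n + i))))
      sums (of_real (weyl_inverse a n - weyl_inverse a (Suc n)) :: complex)"
    unfolding of_real_mult[symmetric] by (subst sums_of_real_iff) (simp add: right_diff_distrib)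
  then show ?thesis
    unfolding weyl_difference_def fps_expansion_one_minus_times_Ln by (simp add: sums_iff)
qed

text \<open>The coefficient at 0 does not follow the difference pattern. The kernel recurrence and
  partial fractions (\<open>split\<close>) reduce the remaining sum to the known series
  \<open>k0\<close> and \<open>k1\<close>.\<close>

lemma weyl_difference_log_0:
  assumes "a \<ge> 0"
  shows "weyl_difference a (fps_nth (fps_expansion (\<lambda>z. (1 - z) * Ln (1 - z)) 0)) 0
    = of_real (- (1 + a) * weyl_inverse a 0 - a)"
proof -
  define k where "k = cesaro_kernel (- a)"
  have k1: "(\<lambda>i. k (Suc i) / real (Suc i)) sums weyl_inverse a 0"
    using weyl_inverse_sums[OF assms, of 0] unfolding k_def by (subst sums_Suc_iff) simp
  have k0: "(\<lambda>i. k i / real (Suc i)) sums (1 / (a + 1))"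
    using weyl_inverse_sums[OF assms, of 1] weyl_inverse_1[OF assms] by (simp add: k_def)
  have split: "k (Suc (Suc i)) / real (Suc i)
      = (1 + a) * (k (Suc i) / real (Suc (Suc i))) - a * (k (Suc i) / real (Suc i))" for i
  proof -
    have "k (Suc (Suc i)) = (real (Suc i) - a) * k (Suc i) / real (Suc (Suc i))"
      using cesaro_kernel_Suc[of "Suc i" "- a"] by (simp add: k_def field_simps)
    then show ?thesis
      by (simp only:) (simp add: field_simps)
  qed
  have "(\<lambda>i. k (Suc i) / real (Suc (Suc i))) sums (1 / (a + 1) - 1)"
    using k0 by (subst sums_Suc_iff) (simp add: k_def)
  then have "(\<lambda>i. k (Suc (Suc i)) / real (Suc i)) sums ((1 + a) * (1 / (a + 1) - 1) - a * weyl_inverse a 0)"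
    unfolding split by (intro sums_diff sums_mult k1)
  then have "(\<lambda>i. k (Suc i) / real i) sums ((1 + a) * (1 / (a + 1) - 1) - a * weyl_inverse a 0)"
    by (subst (asm) sums_Suc_iff) simp
  from sums_diff[OF this k1]
  have "(\<lambda>i. k (Suc i) * (1 / real i - 1 / real (Suc i)))
      sums ((1 + a) * (1 / (a + 1) - 1) - a * weyl_inverse a 0 - weyl_inverse a 0)"
    by (simp add: right_diff_distrib)
  moreover have "(1 + a) * (1 / (a + 1) - 1) - a * weyl_inverse a 0 - weyl_inverse a 0
      = - (1 + a) * weyl_inverse a 0 - a"
    using assms by (simp add: field_simps)
  ultimately have "(\<lambda>i. k (Suc i) * (1 / real i - 1 / real (Suc i))) sums (- (1 + a) * weyl_inverse a 0 - a)"
    by (simp only:)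
  then have "(\<lambda>i. complex_of_real (k (Suc i) * (1 / real i - 1 / real (Suc i)))) sums of_real (- (1 + a) * weyl_inverse a 0 - a)"
    by (subst sums_of_real_iff)
  then have "(\<lambda>i. complex_of_real (k (Suc i)) * (case Suc i of 0 \<Rightarrow> 0 | Suc m \<Rightarrow> of_real (1 / real m - 1 / real (Suc m))))
      sums of_real (- (1 + a) * weyl_inverse a 0 - a)"
    by (simp only: of_real_mult nat.case)
  from sums_Suc_imp[OF _ this] have "(\<lambda>i. complex_of_real (k i) * (case i of 0 \<Rightarrow> 0 | Suc m \<Rightarrow> of_real (1 / real m - 1 / real (Suc m))))
      sums of_real (- (1 + a) * weyl_inverse a 0 - a)"
    by simp
  then show ?thesis
    unfolding weyl_difference_def fps_expansion_one_minus_times_Ln by (simp add: sums_iff k_def)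
qed

text \<open>Consecutive ratios of \<open>p\<close> are \<open>1 + O(1/n^2)\<close>, so its
  increments are eventually dominated by those of \<open>d / n\<close>, and summing them to infinity
  gives the rate. The limit \<open>1 / Gamma (a + 1)\<close> comes from Gauss's limit formula for
  Gamma.\<close>

lemma cesaro_kernel_asymptotics:
  assumes "a \<ge> 0"
  obtains l c where "l > 0" "\<And>n. n \<ge> 1 \<Longrightarrow> \<bar>cesaro_kernel (a + 1) n / real n powr a - l\<bar> \<le> c / real n"
proof -
  define p where "p n = cesaro_kernel (a + 1) n / real n powr a" for n
  define l where "l = 1 / Gamma (a + 1)"
  have ppos: "p n > 0" if "n \<ge> 1" for n
    using that assms cesaro_kernel_pos[of "a + 1" n] by (simp add: p_def)
  have lpos: "l > 0" using assms by (simp add: l_def Gamma_real_pos)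
  have lim: "p \<longlonglongrightarrow> l"
  proof -
    have "(\<lambda>n. (real n / (real n + a + 1)) / Gamma_series (a + 1) n) \<longlonglongrightarrow> 1 / Gamma (a + 1)"
      using Gamma_real_pos[of "a + 1"] assms
      by (intro tendsto_divide Gamma_series_LIMSEQ) (real_asymp, linarith)
    then show ?thesis
      unfolding l_def
    proof (rule Lim_transform_eventually)
      show "\<forall>\<^sub>F n in sequentially. (real n / (real n + a + 1)) / Gamma_series (a + 1) n = p n"
        using eventually_ge_at_top[of 1]
      proof eventually_elim
        case (elim n)
        have "exp ((a + 1) * ln (real n)) = real n * real n powr a"
          using elim by (simp add: powr_def ring_distribs exp_add)
        then have "Gamma_series (a + 1) n
            = fact n * (real n * real n powr a) / (pochhammer (a + 1) n * (real n + a + 1))"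
          by (simp add: Gamma_series_def pochhammer_Suc add_ac)
        moreover have "real n + a + 1 > 0" using assms by simp
        ultimately show ?case
          using elim by (simp add: p_def cesaro_kernel_def)
      qed
    qed
  qed
  have "(\<lambda>n. (real n + 1 + a) / (real n + 1) * (real n / (real n + 1)) powr a - 1) \<in> O(\<lambda>n. 1 / (real n * (real n + 1)))"
    by real_asymp
  then obtain b where b: "b > 0" "\<forall>\<^sub>F n in sequentially.
      norm ((real n + 1 + a) / (real n + 1) * (real n / (real n + 1)) powr a - 1) \<le> b * norm (1 / (real n * (real n + 1)))"
    by (elim landau_o.bigE)
  from order_tendstoD(2)[OF lim, of "l + 1"] have "\<forall>\<^sub>F n in sequentially. p n < l + 1" by simp
  from eventually_conj[OF b(2) eventually_conj[OF this eventually_ge_at_top[of 1]]]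
  obtain n0 where n0: "\<And>n. n \<ge> n0 \<Longrightarrow>
      norm ((real n + 1 + a) / (real n + 1) * (real n / (real n + 1)) powr a - 1) \<le> b * norm (1 / (real n * (real n + 1)))"
    "\<And>n. n \<ge> n0 \<Longrightarrow> p n < l + 1" "\<And>n. n \<ge> n0 \<Longrightarrow> n \<ge> 1"
    unfolding eventually_sequentially by blast
  define d where "d = b * (l + 1)"
  have step: "\<bar>p (Suc n) - p n\<bar> \<le> d / real n - d / real (Suc n)" if n: "n \<ge> n0" for n
  proof -
    have n1: "n \<ge> 1" using n0(3) n by auto
    have "p (Suc n) = p n * ((real n + 1 + a) / (real n + 1) * (real n / (real n + 1)) powr a)"
    proof -
      have "cesaro_kernel (a + 1) (Suc n) = (real n + 1 + a) / (real n + 1) * cesaro_kernel (a + 1) n"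
        using cesaro_kernel_Suc[of n "a + 1"] by (simp add: field_simps)
      moreover have "(real n / (real n + 1)) powr a = real n powr a / real (Suc n) powr a"
        by (simp add: powr_divide add.commute)
      ultimately show ?thesis unfolding p_def using n1 by (simp only:) simp
    qed
    then have "p (Suc n) - p n = p n * ((real n + 1 + a) / (real n + 1) * (real n / (real n + 1)) powr a - 1)"
      by (simp add: right_diff_distrib)
    then have "\<bar>p (Suc n) - p n\<bar> = p n * norm ((real n + 1 + a) / (real n + 1) * (real n / (real n + 1)) powr a - 1)"
      using ppos[OF n1] by (simp add: abs_mult)
    also have "\<dots> \<le> (l + 1) * (b * norm (1 / (real n * (real n + 1))))"
      using n0(2)[OF n] ppos[OF n1] lpos n by (intro mult_mono n0(1)) auto
    also have "\<dots> = d / real n - d / real (Suc n)"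
      using n1 by (simp add: d_def field_simps)
    finally show ?thesis .
  qed
  have tail: "\<bar>p m - p n\<bar> \<le> d / real n - d / real m" if "n \<ge> n0" "m \<ge> n" for m n
    using that(2)
  proof (induction m rule: dec_induct)
    case (step m)
    then show ?case using \<open>\<And>n. n \<ge> n0 \<Longrightarrow> \<bar>p (Suc n) - p n\<bar> \<le> _\<close>[of m] that(1) by linarith
  qed simp
  have ev: "\<bar>p n - l\<bar> \<le> d / real n" if n: "n \<ge> n0" for n
  proof -
    have "(\<lambda>m. \<bar>p m - p n\<bar>) \<longlonglongrightarrow> \<bar>l - p n\<bar>" by (intro tendsto_intros lim)
    moreover have "\<bar>p m - p n\<bar> \<le> d / real n" if "m \<ge> n" for m
    proof -
      have "d / real m \<ge> 0" using b(1) lpos by (simp add: d_def)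
      then show ?thesis using tail[OF n that] by linarith
    qed
    ultimately have "\<bar>l - p n\<bar> \<le> d / real n" by (intro LIMSEQ_le_const2) auto
    then show ?thesis by (simp add: abs_minus_commute)
  qed
  \<comment> \<open>Finitely many early indices are absorbed into the constant.\<close>
  define c where "c = d + (\<Sum>n\<le>n0. real n * \<bar>p n - l\<bar>)"
  have "\<bar>p n - l\<bar> \<le> c / real n" if n: "n \<ge> 1" for n
  proof -
    have "real n * \<bar>p n - l\<bar> \<le> c"
    proof (cases "n \<ge> n0")
      case True
      have "real n * \<bar>p n - l\<bar> \<le> d" using ev[OF True] n by (simp add: field_simps)
      moreover have "(\<Sum>n\<le>n0. real n * \<bar>p n - l\<bar>) \<ge> 0" by (intro sum_nonneg) auto
      ultimately show ?thesis by (simp add: c_def)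
    next
      case False
      then have "real n * \<bar>p n - l\<bar> \<le> (\<Sum>n\<le>n0. real n * \<bar>p n - l\<bar>)"
        by (intro member_le_sum) auto
      moreover have "d \<ge> 0" using b(1) lpos by (simp add: d_def)
      ultimately show ?thesis by (simp add: c_def)
    qed
    then show ?thesis using n by (simp add: field_simps)
  qed
  then show ?thesis using that[OF lpos] by (auto simp: p_def)
qed

subsection \<open>Separation of points by bounded functionals\<close>

definition sublinear :: "('a::real_vector \<Rightarrow> real) \<Rightarrow> bool" where
  "sublinear p \<longleftrightarrow> (\<forall>x y. p (x + y) \<le> p x + p y) \<and> (\<forall>x r. r > 0 \<longrightarrow> p (r *\<^sub>R x) = r * p x) \<and> p 0 = 0"

lemma sublinear_neg:
  assumes "sublinear p"
  shows "- p (- x) \<le> p x"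
proof -
  have "p (x + - x) \<le> p x + p (- x)" "p 0 = 0" using assms unfolding sublinear_def by blast+
  then show ?thesis by simp
qed

lemma sublinear_scaleR: "sublinear p \<Longrightarrow> r \<ge> 0 \<Longrightarrow> p (r *\<^sub>R x) = r * p x"
  unfolding sublinear_def by (cases "r = 0") auto

text \<open>Moving in the direction \<open>y\<close> gives a smaller sublinear functional whose value at \<open>- y\<close> is at most
  \<open>- p y\<close>; hence a minimal sublinear functional is odd, that is, linear.\<close>

lemma sublinear_directional_inf:
  fixes p :: "'a::real_vector \<Rightarrow> real"
  assumes p: "sublinear p"
  obtains q where "sublinear q" "\<And>x. q x \<le> p x" "q (- y) \<le> - p y"
proof
  define q where "q x = (INF t\<in>{0..}. p (x + t *\<^sub>R y) - t * p y)" for x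
  have add: "p (u + v) \<le> p u + p v" for u v using p by (simp add: sublinear_def)
  have low: "- p (- x) \<le> p (x + t *\<^sub>R y) - t * p y" if "t \<ge> 0" for x t
  proof -
    have "t * p y = p (t *\<^sub>R y)" using p that by (simp add: sublinear_scaleR)
    also have "\<dots> = p ((x + t *\<^sub>R y) + (- x))" by simp
    also have "\<dots> \<le> p (x + t *\<^sub>R y) + p (- x)" by (rule add)
    finally show ?thesis by simp
  qed
  have le: "q x \<le> p (x + t *\<^sub>R y) - t * p y" if "t \<ge> 0" for x t
    unfolding q_def using that low by (intro cINF_lower bdd_belowI2[of _ "- p (- x)"]) auto
  have ge: "c \<le> q x" if "\<And>t. t \<ge> 0 \<Longrightarrow> c \<le> p (x + t *\<^sub>R y) - t * p y" for c x
    unfolding q_def using that by (intro cINF_greatest) auto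
  show qp: "q x \<le> p x" for x using le[of 0 x] by simp
  show "q (- y) \<le> - p y" using le[of 1 "- y"] p by (simp add: sublinear_def)
  show "sublinear q"
    unfolding sublinear_def
  proof (intro conjI allI impI)
    fix u v
    have "q (u + v) - (p (u + t *\<^sub>R y) - t * p y) \<le> q v" if t: "t \<ge> 0" for t
    proof (rule ge)
      fix s :: real assume s: "s \<ge> 0"
      have "q (u + v) \<le> p (u + v + (t + s) *\<^sub>R y) - (t + s) * p y"
        using le[of "t + s" "u + v"] s t by simp
      also have "p (u + v + (t + s) *\<^sub>R y) \<le> p (u + t *\<^sub>R y) + p (v + s *\<^sub>R y)"
        using add[of "u + t *\<^sub>R y" "v + s *\<^sub>R y"] by (simp add: algebra_simps)
      finally show "q (u + v) - (p (u + t *\<^sub>R y) - t * p y) \<le> p (v + s *\<^sub>R y) - s * p y"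
        by (simp add: algebra_simps)
    qed
    then have "q (u + v) - q v \<le> q u" by (intro ge) (simp add: algebra_simps)
    then show "q (u + v) \<le> q u + q v" by simp
  next
    fix x and r :: real assume r: "r > 0"
    have scale: "q (r *\<^sub>R x) \<le> r * q x" if r: "r > 0" for r x
    proof -
      have "q (r *\<^sub>R x) / r \<le> q x"
      proof (rule ge)
        fix t :: real assume t: "t \<ge> 0"
        have "q (r *\<^sub>R x) \<le> p (r *\<^sub>R (x + t *\<^sub>R y)) - (r * t) * p y"
          using le[of "r * t" "r *\<^sub>R x"] r t by (simp add: algebra_simps)
        also have "\<dots> = r * (p (x + t *\<^sub>R y) - t * p y)"
          using p r sublinear_scaleR[of p r "x + t *\<^sub>R y"] by (simp add: algebra_simps)
        finally show "q (r *\<^sub>R x) / r \<le> p (x + t *\<^sub>R y) - t * p y"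
          using r by (simp add: field_simps)
      qed
      then show ?thesis using r by (simp add: field_simps)
    qed
    have "r * q x = r * q (inverse r *\<^sub>R r *\<^sub>R x)" using r by simp
    also have "\<dots> \<le> r * (inverse r * q (r *\<^sub>R x))"
      using scale[of "inverse r" "r *\<^sub>R x"] r by (intro mult_left_mono) auto
    finally have "r * q x \<le> q (r *\<^sub>R x)" using r by (simp add: field_simps)
    then show "q (r *\<^sub>R x) = r * q x" using scale[OF r, of x] by simp
  next
    have "0 \<le> q 0" using p sublinear_scaleR[OF p] by (intro ge) simp
    then show "q 0 = 0" using qp[of 0] p by (simp add: sublinear_def)
  qed
qed

text \<open>Zorn's lemma for the reversed pointwise order gives a minimal sublinear functional below
  \<open>p\<close>. A chain has its pointwise infimum as lower bound, finite because every member is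
  at least \<open>- p (- x)\<close> at \<open>x\<close>. Minimality against the directional infimum
  forces oddness.\<close>

lemma linear_below_sublinear:
  fixes p :: "'a::real_vector \<Rightarrow> real"
  assumes p: "sublinear p"
  obtains f where "linear f" "\<And>x. f x \<le> p x"
proof -
  define S where "S = {q. sublinear q \<and> q \<le> p}"
  have "\<exists>m\<in>S. \<forall>a\<in>S. a \<le> m \<longrightarrow> a = m"
  proof (rule predicate_Zorn[where P = "\<lambda>a b. b \<le> a"])
    show "partial_order_on S (relation_of (\<lambda>a b. b \<le> a) S)"
      by (rule partial_order_on_relation_ofI) auto
    fix C assume C: "C \<in> Chains (relation_of (\<lambda>a b. b \<le> a) S)"
    have CS: "q \<in> S" if "q \<in> C" for q
      using C that by (auto simp: Chains_def relation_of_def)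
    have chain: "q \<le> q' \<or> q' \<le> q" if "q \<in> C" "q' \<in> C" for q q'
      using C that by (auto simp: Chains_def relation_of_def)
    show "\<exists>u\<in>S. \<forall>a\<in>C. u \<le> a"
    proof (cases "C = {}")
      case True
      then show ?thesis using p by (auto simp: S_def)
    next
      case False
      define u where "u x = (INF q\<in>C. q x)" for x
      have low: "- p (- x) \<le> q x" if "q \<in> C" for q x
        using CS[OF that] sublinear_neg[of q x] le_funD[of q p "- x"] by (simp add: S_def)
      have le: "u x \<le> q x" if "q \<in> C" for q x
        unfolding u_def using that low by (intro cINF_lower bdd_belowI2[of _ "- p (- x)"]) auto
      have ge: "c \<le> u x" if "\<And>q. q \<in> C \<Longrightarrow> c \<le> q x" for c x
        unfolding u_def using that False by (intro cINF_greatest) auto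
      have "sublinear u"
        unfolding sublinear_def
      proof (intro conjI allI impI)
        fix x y
        have "u (x + y) \<le> q x + q' y" if q: "q \<in> C" "q' \<in> C" for q q'
        proof -
          \<comment> \<open>Subadditivity of the infimum involves two members of the chain at
            different points; the smaller one serves for both.\<close>
          obtain r where r: "r \<in> C" "r \<le> q" "r \<le> q'"
            using chain[OF q] q by auto
          have "u (x + y) \<le> r x + r y"
            using CS[OF r(1)] by (intro order_trans[OF le[OF r(1)]]) (simp add: S_def sublinear_def)
          also have "\<dots> \<le> q x + q' y" using r by (intro add_mono) (auto simp: le_fun_def)
          finally show ?thesis .
        qed
        then have "u (x + y) - q x \<le> u y" if "q \<in> C" for q
          using that by (intro ge) (simp add: diff_le_eq add.commute[of "_ y"])
        then have "u (x + y) - u y \<le> u x"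
          by (intro ge) (simp add: algebra_simps)
        then show "u (x + y) \<le> u x + u y" by simp
      next
        fix x and r :: real assume r: "r > 0"
        have q: "q (r *\<^sub>R x) = r * q x" if "q \<in> C" for q
          using CS[OF that] r by (simp add: S_def sublinear_def)
        have "u (r *\<^sub>R x) / r \<le> u x"
          using le[of _ "r *\<^sub>R x"] q r by (intro ge) (simp add: field_simps)
        moreover have "r * u x \<le> u (r *\<^sub>R x)"
          using le[of _ x] q r by (intro ge) (metis less_imp_le mult_left_mono)
        ultimately show "u (r *\<^sub>R x) = r * u x" using r by (simp add: field_simps)
      next
        have "q 0 = 0" if "q \<in> C" for q using CS[OF that] by (simp add: S_def sublinear_def)
        then have "(\<lambda>q. q 0) ` C = {0}" using False by force
        then show "u 0 = 0" unfolding u_def by simp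
      qed
      moreover have "u \<le> p"
      proof (rule le_funI)
        fix x
        obtain q where "q \<in> C" using False by blast
        then show "u x \<le> p x" using le[of q x] CS[of q] le_funD[of q p x] by (simp add: S_def)
      qed
      ultimately show ?thesis using le by (auto simp: S_def le_fun_def)
    qed
  qed
  then obtain f where f: "sublinear f" "f \<le> p" and minimal: "\<And>q. sublinear q \<Longrightarrow> q \<le> f \<Longrightarrow> q = f"
    unfolding S_def by (metis (no_types, lifting) mem_Collect_eq order_trans)
  have odd: "f (- y) = - f y" for y
  proof -
    obtain q where q: "sublinear q" "\<And>x. q x \<le> f x" "q (- y) \<le> - f y"
      using sublinear_directional_inf[OF f(1)] by blast
    then have "q = f" by (intro minimal) (auto simp: le_fun_def)
    then show ?thesis using q(3) sublinear_neg[OF f(1), of y] by simp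
  qed
  have "linear f"
  proof (rule linearI)
    fix x y
    have "f x = f (x + y + - y)" by simp
    also have "\<dots> \<le> f (x + y) + f (- y)" using f(1) unfolding sublinear_def by blast
    finally have "f x + f y \<le> f (x + y)" by (simp add: odd)
    moreover have "f (x + y) \<le> f x + f y" using f(1) unfolding sublinear_def by blast
    ultimately show "f (x + y) = f x + f y" by simp
  next
    fix r x
    show "f (r *\<^sub>R x) = r *\<^sub>R f x"
      using sublinear_scaleR[OF f(1), of "\<bar>r\<bar>" x] odd[of "r *\<^sub>R x"]
      by (cases "r \<ge> 0") auto
  qed
  then show ?thesis using that f(2) by (auto simp: le_fun_def)
qed

text \<open>The norm is first lowered in the direction \<open>z\<close>; a linear functional below
  the result satisfies \<open>f (- z) \<le> - norm z\<close>, and it stays dominated by the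
  norm.\<close>

lemma bounded_linear_functional_nonzero:
  fixes z :: "'a::real_normed_vector"
  assumes "z \<noteq> 0"
  obtains f :: "'a \<Rightarrow> real" where "bounded_linear f" "f z \<noteq> 0"
proof -
  have "sublinear (norm :: 'a \<Rightarrow> real)" by (simp add: sublinear_def norm_triangle_ineq)
  then obtain q where q: "sublinear q" "\<And>x. q x \<le> norm x" "q (- z) \<le> - norm z"
    using sublinear_directional_inf[of norm z] by metis
  obtain f where f: "linear f" "\<And>x. f x \<le> q x"
    using linear_below_sublinear[OF q(1)] by blast
  have "\<bar>f x\<bar> \<le> norm x * 1" for x
    using f(2)[of x] f(2)[of "- x"] q(2)[of x] q(2)[of "- x"] linear_neg[OF f(1), of x] by simp
  then have "bounded_linear f"
    using f(1) by (intro bounded_linear_intro[where K = 1]) (auto simp: linear_add linear_scale)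
  moreover have "f z \<noteq> 0"
    using f(2)[of "- z"] q(3) assms linear_neg[OF f(1), of z] zero_less_norm_iff[of z] by linarith
  ultimately show ?thesis by (rule that)
qed

lemma clinear_iff:
  "clinear f \<longleftrightarrow> (\<forall>x y. f (x + y) = f x + f y) \<and> (\<forall>c x. f (c *\<^sub>C x) = c *\<^sub>C f x)"
  unfolding clinear_def Vector_Spaces.linear_def module_hom_def module_hom_axioms_def
    vector_space_def module_def
  by (auto simp: scaleC_add_right scaleC_add_left scaleC_scaleC scaleC_one)

text \<open>The usual complexification \<open>f x - i f(i x)\<close>, whose real part is
  \<open>f\<close>, of a real functional.\<close>

lemma clinear_functional_nonzero:
  fixes z :: "'a::complex_normed_vector"
  assumes "z \<noteq> 0"
  obtains \<phi> :: "'a \<Rightarrow>\<^sub>L complex" where "clinear \<phi>" "\<phi> z \<noteq> 0"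
proof -
  obtain f :: "'a \<Rightarrow> real" where f: "bounded_linear f" "f z \<noteq> 0"
    using bounded_linear_functional_nonzero[OF assms] by blast
  define g where "g x = Complex (f x) (- f (\<i> *\<^sub>C x))" for x
  have lin: "linear f" using f(1) by (rule bounded_linear.linear)
  have g_alt: "g x = of_real (f x) - of_real (f (\<i> *\<^sub>C x)) * \<i>" for x
    by (simp add: g_def complex_eq_iff)
  have "bounded_linear (\<lambda>x. of_real (f x) - of_real (f (\<i> *\<^sub>C x)) * \<i> :: complex)"
    by (intro bounded_linear_sub bounded_linear_compose[OF bounded_linear_mult_left]
        bounded_linear_compose[OF bounded_linear_of_real] f(1)
        bounded_linear_compose[OF f(1) bounded_linear_scaleC])
  then have g: "bounded_linear g" by (simp add: g_alt[abs_def])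
  define \<phi> where "\<phi> = Blinfun g"
  have \<phi>: "\<phi> x = g x" for x by (simp add: \<phi>_def bounded_linear_Blinfun_apply[OF g])
  have "f (c *\<^sub>C x) = Re c * f x + Im c * f (\<i> *\<^sub>C x)" for c x
  proof -
    have "c *\<^sub>C x = Re c *\<^sub>R x + Im c *\<^sub>R \<i> *\<^sub>C x"
      by (subst (1) complex_eq) (simp add: scaleC_add_left scaleC_of_real mult.commute[of \<i>] flip: scaleC_scaleC)
    then show ?thesis by (simp add: linear_add[OF lin] linear_scale[OF lin])
  qed
  note fc = this
  have "clinear \<phi>"
    unfolding clinear_iff
  proof (intro conjI allI)
    show "\<phi> (x + y) = \<phi> x + \<phi> y" for x y by (rule blinfun.add_right)
    show "\<phi> (c *\<^sub>C x) = c *\<^sub>C \<phi> x" for c x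
      unfolding \<phi> g_def scaleC_complex_def scaleC_scaleC
      by (subst (1 2) fc) (simp add: complex_eq_iff algebra_simps)
  qed
  moreover have "\<phi> z \<noteq> 0" using f(2) by (simp add: \<phi> g_def complex_eq_iff)
  ultimately show ?thesis by (rule that)
qed

subsection \<open>Convergence of the logarithmic series of means\<close>

lemma tendsto_zero_on_closure:
  fixes F :: "nat \<Rightarrow> 'a::real_normed_vector \<Rightarrow>\<^sub>L 'b::real_normed_vector"
  assumes bound: "\<And>n. n \<ge> 1 \<Longrightarrow> norm (F n) \<le> B"
    and conv: "\<And>y. y \<in> D \<Longrightarrow> (\<lambda>n. F n y) \<longlonglongrightarrow> 0"
    and x: "x \<in> closure D"
  shows "(\<lambda>n. F n x) \<longlonglongrightarrow> 0"
proof (rule LIMSEQ_I)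
  fix e :: real assume e: "e > 0"
  define B' where "B' = max B 0 + 1"
  have B': "B' > 0" "\<And>n. n \<ge> 1 \<Longrightarrow> norm (F n) \<le> B'"
    using bound unfolding B'_def by fastforce+
  obtain y where y: "y \<in> D" "dist y x < e / (2 * B')"
    using x e B'(1) unfolding closure_approachable by (meson divide_pos_pos mult_pos_pos zero_less_numeral)
  obtain n0 where n0: "\<And>n. n \<ge> n0 \<Longrightarrow> norm (F n y) < e / 2"
    using LIMSEQ_D[OF conv[OF y(1)], of "e / 2"] e by auto
  have "norm (F n x - 0) < e" if n: "n \<ge> max n0 1" for n
  proof -
    have "norm (F n (x - y)) \<le> norm (F n) * norm (x - y)" by (rule norm_blinfun)
    also have "\<dots> \<le> B' * norm (x - y)"
      using B'(2)[of n] n by (simp add: mult_right_mono)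
    also have "\<dots> \<le> e / 2"
      using y(2) B'(1) by (simp add: dist_norm norm_minus_commute field_simps)
    finally have "norm (F n (x - y)) \<le> e / 2" .
    moreover have "F n x = F n (x - y) + F n y" by (simp add: blinfun.diff_right)
    ultimately show ?thesis using n0[of n] n norm_triangle_ineq[of "F n (x - y)" "F n y"] by simp
  qed
  then show "\<exists>no. \<forall>n\<ge>no. norm (F n x - 0) < e" by blast
qed

text \<open>Dividing the increments of \<open>y\<close> by \<open>h\<close> recovers those of
  \<open>a\<close>. As \<open>1 / h\<close> does not increase, summation by parts bounds
  \<open>a n - a m\<close> by a small multiple of \<open>1 / h n\<close> uniformly in
  \<open>m\<close>; then \<open>m\<close> tends to infinity.\<close>

lemma tendsto_zero_of_weighted_increments:
  fixes a y :: "nat \<Rightarrow> 'a::real_normed_vector" and h :: "nat \<Rightarrow> real"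
  assumes h: "\<And>n. n \<ge> 1 \<Longrightarrow> h n > 0" "\<And>n. n \<ge> 1 \<Longrightarrow> h n \<le> h (Suc n)"
    and a: "a \<longlonglongrightarrow> 0" and y: "y \<longlonglongrightarrow> 0"
    and inc: "\<And>n. n \<ge> 1 \<Longrightarrow> y n - y (Suc n) = h n *\<^sub>R (a n - a (Suc n))"
  shows "(\<lambda>n. h n *\<^sub>R a n) \<longlonglongrightarrow> 0"
proof (rule LIMSEQ_I)
  fix e :: real assume e: "e > 0"
  \<comment> \<open>Three terms of at most \<open>e / 4\<close>, up to the factor
    \<open>1 / h n\<close>, arise below, so the limit in \<open>m\<close> stays strictly below
    \<open>e\<close>.\<close>
  obtain n0 where n0: "\<And>n. n \<ge> n0 \<Longrightarrow> norm (y n) < e / 4"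
    using LIMSEQ_D[OF y, of "e / 4"] e by auto
  have "norm (h n *\<^sub>R a n - 0) < e" if n: "n \<ge> max n0 1" for n
  proof -
    have n1: "n \<ge> 1" "n \<ge> n0" using n by auto
    have hn: "h n > 0" using h(1) n1 by auto
    have hm: "h m > 0 \<and> h n \<le> h m" if "m \<ge> n" for m
      using that by (induction m rule: dec_induct) (use h n1 in \<open>auto intro: order_trans\<close>)
    \<comment> \<open>summation by parts\<close>
    have parts: "norm (a n - a m - (y n /\<^sub>R h n - y m /\<^sub>R h m)) \<le> (1 / h n - 1 / h m) * (e / 4)" if "m \<ge> n" for m
      using that
    proof (induction m rule: dec_induct)
      case base
      then show ?case by simp
    next
      case (step m)
      have m: "h m > 0" "h (Suc m) > 0" "h m \<le> h (Suc m)"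
        using hm[of m] hm[of "Suc m"] step h(2)[of m] n1 by auto
      have "a m - a (Suc m) = (y m - y (Suc m)) /\<^sub>R h m"
        using inc[of m] step n1 m by simp
      then have "a n - a (Suc m) - (y n /\<^sub>R h n - y (Suc m) /\<^sub>R h (Suc m))
          = (a n - a m - (y n /\<^sub>R h n - y m /\<^sub>R h m)) - (1 / h m - 1 / h (Suc m)) *\<^sub>R y (Suc m)"
        by (simp add: algebra_simps divide_inverse)
      also have "norm \<dots> \<le> (1 / h n - 1 / h m) * (e / 4) + (1 / h m - 1 / h (Suc m)) * (e / 4)"
      proof (rule order_trans[OF norm_triangle_ineq4 add_mono])
        have "1 / h m - 1 / h (Suc m) \<ge> 0" using m by (simp add: frac_le)
        then show "norm ((1 / h m - 1 / h (Suc m)) *\<^sub>R y (Suc m)) \<le> (1 / h m - 1 / h (Suc m)) * (e / 4)"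
          using n0[of "Suc m"] step n1 mult_left_mono[of "norm (y (Suc m))" "e / 4" "1 / h m - 1 / h (Suc m)"]
          by simp
      qed (rule step.IH)
      finally show ?case by (simp add: algebra_simps)
    qed
    have "norm (h n *\<^sub>R (a n - a m)) \<le> 3 * (e / 4)" if m: "m \<ge> n" for m
    proof -
      have pos: "h m > 0" "h n \<le> h m" using hm m by auto
      have "norm (a n - a m) \<le> norm (y n /\<^sub>R h n) + norm (y m /\<^sub>R h m) + (1 / h n - 1 / h m) * (e / 4)"
        using parts[OF m] norm_triangle_ineq4[of "y n /\<^sub>R h n" "y m /\<^sub>R h m"]
          norm_triangle_sub[of "a n - a m" "y n /\<^sub>R h n - y m /\<^sub>R h m"] by linarith
      also have "\<dots> \<le> (e / 4) / h n + (e / 4) / h n + (e / 4) / h n"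
      proof (intro add_mono)
        show "norm (y n /\<^sub>R h n) \<le> e / 4 / h n"
          using n0[of n] n1 hn by (simp add: field_simps)
        have "norm (y m /\<^sub>R h m) = norm (y m) / h m"
          using pos by (simp add: field_simps)
        also have "\<dots> \<le> e / 4 / h n"
          using n0[of m] m n1 hn pos e by (intro frac_le) auto
        finally show "norm (y m /\<^sub>R h m) \<le> e / 4 / h n" .
        have "(1 / h n - 1 / h m) * (e / 4) \<le> (1 / h n) * (e / 4)"
          using pos e by (intro mult_right_mono) auto
        then show "(1 / h n - 1 / h m) * (e / 4) \<le> e / 4 / h n" by simp
      qed
      finally have "h n * norm (a n - a m) \<le> 3 * (e / 4)" using hn by (simp add: field_simps)
      then show ?thesis using hn by (simp del: scaleR_diff_right)
    qed
    moreover have "(\<lambda>m. norm (h n *\<^sub>R (a n - a m))) \<longlonglongrightarrow> norm (h n *\<^sub>R (a n - 0))"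
      by (intro tendsto_intros a)
    ultimately have "norm (h n *\<^sub>R (a n - 0)) \<le> 3 * (e / 4)"
      by (intro LIMSEQ_le_const2) auto
    then show ?thesis using e by simp
  qed
  then show "\<exists>no. \<forall>n\<ge>no. norm (h n *\<^sub>R a n - 0) < e" by blast
qed

lemma harm_over_n_tendsto_0: "(\<lambda>n. harm n / real n) \<longlonglongrightarrow> 0"
proof -
  have "(\<lambda>n. (harm n - ln (real n)) * (1 / real n) + ln (real n) / real n) \<longlonglongrightarrow> euler_mascheroni * 0 + 0"
    by (intro tendsto_intros euler_mascheroni_LIMSEQ lim_1_over_n lim_ln_over_n)
  then show ?thesis
    by (simp add: diff_divide_distrib)
qed

lemma norm_blinfun_apply_le:
  "norm F \<le> b \<Longrightarrow> norm (blinfun_apply F x) \<le> b * norm x"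
  by (meson mult_right_mono norm_blinfun norm_ge_zero order_trans)

text \<open>On the range of \<open>A\<close> the means are \<open>O(1/n)\<close> because they
  commute with \<open>A\<close>; density and uniform boundedness carry the limit to every
  vector.\<close>

lemma cesaro_means_tendsto_zero:
  fixes A :: "'a::real_normed_vector \<Rightarrow>\<^sub>L 'a" and \<sigma> :: "nat \<Rightarrow> 'a \<Rightarrow>\<^sub>L 'a"
  assumes dense: "closure (range A) = UNIV"
    and comm: "\<And>n z. A (\<sigma> n z) = \<sigma> n (A z)"
    and \<sigma>: "\<And>n. n \<ge> 1 \<Longrightarrow> norm (\<sigma> n) \<le> M"
    and A\<sigma>: "\<And>n. n \<ge> 1 \<Longrightarrow> norm (A o\<^sub>L \<sigma> n) \<le> M / n"
  shows "(\<lambda>n. \<sigma> n z) \<longlonglongrightarrow> 0"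
proof (rule tendsto_zero_on_closure)
  fix y assume "y \<in> range A"
  then obtain z where z: "y = A z" by auto
  have "(\<lambda>n. M * norm z * (1 / real n)) \<longlonglongrightarrow> M * norm z * 0"
    by (intro tendsto_intros lim_1_over_n)
  moreover have "\<forall>\<^sub>F n in sequentially. norm (\<sigma> n y) \<le> M * norm z * (1 / real n)"
    using eventually_ge_at_top[of 1]
    by eventually_elim (use norm_blinfun_apply_le[OF A\<sigma>] in \<open>simp add: z comm\<close>)
  ultimately show "(\<lambda>n. \<sigma> n y) \<longlonglongrightarrow> 0"
    by (auto intro: Lim_null_comparison)
qed (use dense \<sigma> in auto)

text \<open>The core of the passage from the domain to norm convergence. In the application
  \<open>c\<close> is the integral plus \<open>1 / (\<alpha> + 1)\<close>, and
  \<open>\<sigma>\<close> are the means of order \<open>\<alpha> + 1\<close>.\<close>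

lemma log_series_tendsto:
  fixes A H :: "'a::real_normed_vector \<Rightarrow>\<^sub>L 'a" and \<sigma> Q :: "nat \<Rightarrow> 'a \<Rightarrow>\<^sub>L 'a"
  defines "L \<equiv> \<lambda>n. \<Sum>j=1..n. (1 / real j) *\<^sub>R \<sigma> j"
  assumes dense: "closure (range A) = UNIV"
    and AQ: "\<And>n z. n \<ge> 1 \<Longrightarrow> A (Q n z) = z - \<sigma> n z"
    and comm: "\<And>n z. A (\<sigma> n z) = \<sigma> n (A z)" "\<And>n z. A (Q n z) = Q n (A z)" "\<And>n z. H (Q n z) = Q n (H z)"
    and \<sigma>: "\<And>n. n \<ge> 1 \<Longrightarrow> norm (\<sigma> n) \<le> M"
    and Q: "\<And>n. n \<ge> 1 \<Longrightarrow> norm (Q n) \<le> M * n"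
    and A\<sigma>: "\<And>n. n \<ge> 1 \<Longrightarrow> norm (A o\<^sub>L \<sigma> n) \<le> M / n"
    and K: "\<And>n. n \<ge> 1 \<Longrightarrow> norm (c *\<^sub>R A - H - (A o\<^sub>L L n)) \<le> M / n"
    and x: "H x = A w"
  shows "(\<lambda>n. L n x) \<longlonglongrightarrow> c *\<^sub>R x - w"
proof -
  define K where "K n = c *\<^sub>R A - H - (A o\<^sub>L L n)" for n
  \<comment> \<open>This is \<open>harm n\<close> times \<open>\<sigma> n\<close> minus
    \<open>L n o\<^sub>L \<sigma> n\<close>, rewritten with \<open>I - \<sigma> j = Q j A\<close>.
    Each of the \<open>n\<close> summands then has norm at most \<open>M * M / n\<close>, so the
    growth of \<open>harm n\<close> disappears.\<close>
  define W where "W n = (\<Sum>j=1..n. (1 / real j) *\<^sub>R (Q j o\<^sub>L (A o\<^sub>L \<sigma> n)))" for n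
  define B where "B n = (K n o\<^sub>L Q n) + c *\<^sub>R \<sigma> n + W n" for n
  have M: "M \<ge> 0" using \<sigma>[of 1] norm_ge_zero[of "\<sigma> 1"] by linarith
  have K: "norm (K n) \<le> M / n" if "n \<ge> 1" for n
    using K[OF that] by (simp add: K_def)
  have L_apply: "L n z = (\<Sum>j=1..n. (1 / real j) *\<^sub>R \<sigma> j z)" for n z
    by (simp add: L_def blinfun.sum_left blinfun.scaleR_left)
  have AL: "A (L n z) = L n (A z)" for n z
    by (simp add: L_apply blinfun.sum_right blinfun.scaleR_right comm)
  have K_apply: "K n z = c *\<^sub>R A z - H z - A (L n z)" for n z
    by (simp add: K_def blinfun.diff_left blinfun.scaleR_left)
  have W_apply: "W n z = harm n *\<^sub>R \<sigma> n z - L n (\<sigma> n z)" for n z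
  proof -
    have "W n z = (\<Sum>j=1..n. (1 / real j) *\<^sub>R (\<sigma> n z - \<sigma> j (\<sigma> n z)))"
      unfolding W_def
      by (simp add: blinfun.sum_left blinfun.scaleR_left flip: comm(2)) (simp add: AQ)
    then show ?thesis
      by (simp add: L_apply harm_def scaleR_diff_right sum_subtractf scaleR_left.sum divide_inverse)
  qed
  have W: "norm (W n) \<le> M * M" if n: "n \<ge> 1" for n
  proof -
    have "norm (W n) \<le> (\<Sum>j=1..n. M * M / n)"
      unfolding W_def
    proof (rule order_trans[OF norm_sum sum_mono])
      fix j assume j: "j \<in> {1..n}"
      have "norm (Q j o\<^sub>L (A o\<^sub>L \<sigma> n)) \<le> (M * j) * (M / n)"
        using Q[of j] A\<sigma>[OF n] j M
        by (intro order_trans[OF norm_blinfun_compose[of "Q j"]] mult_mono) auto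
      then show "norm ((1 / real j) *\<^sub>R (Q j o\<^sub>L (A o\<^sub>L \<sigma> n))) \<le> M * M / n"
        using j by (simp add: field_simps)
    qed
    also have "\<dots> = M * M" using n by simp
    finally show ?thesis .
  qed
  have \<sigma>0: "(\<lambda>n. \<sigma> n z) \<longlonglongrightarrow> 0" for z
    by (rule cesaro_means_tendsto_zero[OF dense comm(1) \<sigma> A\<sigma>])
  have inv_n: "(\<lambda>n. a * (1 / real n)) \<longlonglongrightarrow> 0" for a
    using tendsto_mult[OF tendsto_const lim_1_over_n, of a] by simp
  have A\<sigma>0: "(\<lambda>n. A (\<sigma> n z)) \<longlonglongrightarrow> 0" for z
    using blinfun.tendsto[OF tendsto_const \<sigma>0, of A] by simp
  have KM: "(\<lambda>n. K n (f n)) \<longlonglongrightarrow> 0" if f: "\<And>n. n \<ge> 1 \<Longrightarrow> norm (f n) \<le> b" for f b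
  proof (rule Lim_null_comparison[OF _ inv_n[of "M * b"]])
    show "\<forall>\<^sub>F n in sequentially. norm (K n (f n)) \<le> M * b * (1 / real n)"
      using eventually_ge_at_top[of 1]
    proof eventually_elim
      case (elim n)
      have "norm (K n (f n)) \<le> (M / n) * norm (f n)" by (rule norm_blinfun_apply_le[OF K[OF elim]])
      also have "\<dots> \<le> (M / n) * b" using f[OF elim] M by (intro mult_left_mono) auto
      finally show ?case by simp
    qed
  qed
  have \<sigma>z: "norm (\<sigma> n z) \<le> M * norm z" if "n \<ge> 1" for n z
    by (rule norm_blinfun_apply_le[OF \<sigma>[OF that]])
  have "(\<lambda>n. B n x) \<longlonglongrightarrow> 0"
  proof (rule tendsto_zero_on_closure)
    show "norm (B n) \<le> M * M + \<bar>c\<bar> * M + M * M" if n: "n \<ge> 1" for n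
      unfolding B_def
    proof (intro norm_triangle_le add_mono)
      have "norm (K n o\<^sub>L Q n) \<le> (M / n) * (M * n)"
        using K[OF n] Q[OF n] M by (intro order_trans[OF norm_blinfun_compose] mult_mono) auto
      then show "norm (K n o\<^sub>L Q n) \<le> M * M" using n by simp
      show "norm (c *\<^sub>R \<sigma> n) \<le> \<bar>c\<bar> * M" using \<sigma>[OF n] by (simp add: mult_left_mono)
    qed (rule W[OF n])
  next
    fix y assume "y \<in> range A"
    then obtain z where z: "y = A z" by auto
    \<comment> \<open>On the range of \<open>A\<close> the identity
      \<open>Q n A = I - \<sigma> n\<close> removes the growth of \<open>Q n\<close>, and
      \<open>A (L n (\<sigma> n z))\<close> is expressed through \<open>K n\<close> again.\<close>
    have eq: "B n y = K n (z - \<sigma> n z) + c *\<^sub>R A (\<sigma> n z) + harm n *\<^sub>R A (\<sigma> n z)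
        - (c *\<^sub>R A (\<sigma> n z) - H (\<sigma> n z) - K n (\<sigma> n z))" if n: "n \<ge> 1" for n
      using AQ[OF n, of z]
      by (simp add: B_def blinfun.add_left blinfun.scaleR_left W_apply z flip: comm AL)
        (simp add: K_apply)
    have "(\<lambda>n. K n (z - \<sigma> n z) + c *\<^sub>R A (\<sigma> n z) + harm n *\<^sub>R A (\<sigma> n z)
        - (c *\<^sub>R A (\<sigma> n z) - H (\<sigma> n z) - K n (\<sigma> n z))) \<longlonglongrightarrow> 0 + c *\<^sub>R 0 + 0 - (c *\<^sub>R 0 - H 0 - 0)"
    proof (intro tendsto_intros A\<sigma>0 \<sigma>0)
      show "(\<lambda>n. K n (z - \<sigma> n z)) \<longlonglongrightarrow> 0"
      proof (rule KM)
        show "norm (z - \<sigma> n z) \<le> norm z + M * norm z" if "n \<ge> 1" for n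
          using norm_triangle_ineq4[of z "\<sigma> n z"] \<sigma>z[OF that, of z] by linarith
      qed
      show "(\<lambda>n. K n (\<sigma> n z)) \<longlonglongrightarrow> 0" by (rule KM[OF \<sigma>z])
      show "(\<lambda>n. harm n *\<^sub>R A (\<sigma> n z)) \<longlonglongrightarrow> 0"
      proof (rule Lim_null_comparison)
        show "(\<lambda>n. (M * norm z) * (harm n / real n)) \<longlonglongrightarrow> 0"
          using tendsto_mult[OF tendsto_const harm_over_n_tendsto_0, of "M * norm z"] by simp
        show "\<forall>\<^sub>F n in sequentially. norm (harm n *\<^sub>R A (\<sigma> n z)) \<le> (M * norm z) * (harm n / real n)"
          using eventually_ge_at_top[of 1]
        proof eventually_elim
          case (elim n)
          have "norm (A (\<sigma> n z)) \<le> (M / n) * norm z"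
            using norm_blinfun_apply_le[OF A\<sigma>[OF elim], of z] by simp
          then have "harm n * norm (A (\<sigma> n z)) \<le> harm n * ((M / n) * norm z)"
            by (intro mult_left_mono harm_nonneg)
          then show ?case by (simp add: harm_nonneg field_simps)
        qed
      qed
    qed
    then have "(\<lambda>n. K n (z - \<sigma> n z) + c *\<^sub>R A (\<sigma> n z) + harm n *\<^sub>R A (\<sigma> n z)
        - (c *\<^sub>R A (\<sigma> n z) - H (\<sigma> n z) - K n (\<sigma> n z))) \<longlonglongrightarrow> 0" by simp
    then show "(\<lambda>n. B n y) \<longlonglongrightarrow> 0"
      by (rule Lim_transform_eventually) (rule eventually_sequentiallyI[of 1], simp only: eq)
  qed (simp add: dense)
  then have "(\<lambda>n. B n x - \<sigma> n w) \<longlonglongrightarrow> 0"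
    using tendsto_diff[OF _ \<sigma>0[of w]] by fastforce
  note By = this
  \<comment> \<open>The assumption \<open>H x = A w\<close> enters here: it turns
    \<open>H (Q n x)\<close> into \<open>w - \<sigma> n w\<close>. The terms
    \<open>L n (\<sigma> n x)\<close> from \<open>K n\<close> and \<open>W n\<close> cancel.\<close>
  have y: "B n x - \<sigma> n w = harm n *\<^sub>R \<sigma> n x + (c *\<^sub>R x - w) - L n x" if n: "n \<ge> 1" for n
  proof -
    have "H (Q n x) = w - \<sigma> n w" using AQ[OF n, of w] comm(2,3) x by metis
    moreover have "A (L n (Q n x)) = L n x - L n (\<sigma> n x)"
      using AQ[OF n, of x] by (simp add: AL blinfun.diff_right)
    moreover have "A (Q n x) = x - \<sigma> n x" by (rule AQ[OF n])
    ultimately show ?thesis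
      by (simp add: B_def blinfun.add_left blinfun.scaleR_left W_apply K_apply scaleR_diff_right)
  qed
  from By have y0: "(\<lambda>n. harm n *\<^sub>R \<sigma> n x + (c *\<^sub>R x - w) - L n x) \<longlonglongrightarrow> 0"
    by (rule Lim_transform_eventually) (rule eventually_sequentiallyI[of 1], simp only: y)
  have "(\<lambda>n. harm n *\<^sub>R \<sigma> n x) \<longlonglongrightarrow> 0"
  proof (rule tendsto_zero_of_weighted_increments[OF _ _ \<sigma>0 y0])
    fix n :: nat assume "n \<ge> 1"
    \<comment> \<open>The new summand of \<open>L\<close> cancels the part of
      \<open>harm (Suc n)\<close> beyond \<open>harm n\<close>, leaving increments of the weighted
      form.\<close>
    have "L (Suc n) x = L n x + (1 / real (Suc n)) *\<^sub>R \<sigma> (Suc n) x"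
      by (simp add: L_apply)
    then show "harm n *\<^sub>R \<sigma> n x + (c *\<^sub>R x - w) - L n x
        - (harm (Suc n) *\<^sub>R \<sigma> (Suc n) x + (c *\<^sub>R x - w) - L (Suc n) x)
        = harm n *\<^sub>R (\<sigma> n x - \<sigma> (Suc n) x)"
      by (simp add: harm_Suc algebra_simps divide_inverse)
  qed (auto intro: harm_mono)
  from tendsto_diff[OF this y0] have "(\<lambda>n. L n x - (c *\<^sub>R x - w)) \<longlonglongrightarrow> 0"
    by (simp add: algebra_simps)
  then show ?thesis by (rule LIM_zero_cancel)
qed

subsection \<open>Cesaro bounded operators\<close>

lemma cesaro_sum_0 [simp]: "cesaro_sum a T 0 = id_blinfun"
  by (simp add: cesaro_sum_def blinfun_power_def)

lemma cesaro_sum_Suc: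
  "cesaro_sum a T (Suc n) = (T o\<^sub>L cesaro_sum a T n) + cesaro_kernel a (Suc n) *\<^sub>R id_blinfun"
proof -
  have "cesaro_sum a T (Suc n)
      = cesaro_kernel a (Suc n) *\<^sub>R blinfun_power T 0 + (\<Sum>j\<le>n. cesaro_kernel a (n - j) *\<^sub>R blinfun_power T (Suc j))"
    unfolding cesaro_sum_def by (subst sum.atMost_Suc_shift) simp
  then show ?thesis
    unfolding cesaro_sum_def
    by (simp add: blinfun_power_def bounded_bilinear.sum_right[OF bounded_bilinear_blinfun_compose]
        bounded_bilinear.scaleR_right[OF bounded_bilinear_blinfun_compose])
qed

lemma cesaro_sum_plus1_Suc:
  "cesaro_sum (a + 1) T (Suc n) = cesaro_sum (a + 1) T n + cesaro_sum a T (Suc n)"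
  unfolding cesaro_sum_def
  by (simp add: Suc_diff_le cesaro_kernel_plus1_Suc scaleR_add_left sum.distrib)

text \<open>Two recurrences for \<open>cesaro_sum (a + 1) T (Suc n)\<close> are equated. The
  identity yields \<open>A_Q\<close> at order \<open>\<alpha> + 1\<close> and the decay of
  \<open>A o\<^sub>L \<sigma> n\<close> at order \<open>\<alpha>\<close>.\<close>

lemma one_minus_cesaro_sum_plus1:
  "cesaro_sum (a + 1) T n x - T (cesaro_sum (a + 1) T n x)
     = cesaro_kernel (a + 1) (Suc n) *\<^sub>R x - cesaro_sum a T (Suc n) x"
  using arg_cong[OF cesaro_sum_Suc[of "a + 1" T n], of "\<lambda>F. F x"]
    arg_cong[OF cesaro_sum_plus1_Suc[of a T n], of "\<lambda>F. F x"]
  by (simp add: blinfun.add_left blinfun.scaleR_left algebra_simps)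

lemma cesaro_sum_commute:
  fixes T F :: "'a::real_normed_vector \<Rightarrow>\<^sub>L 'a"
  assumes "\<And>x. F (T x) = T (F x)"
  shows "F (cesaro_sum a T n x) = cesaro_sum a T n (F x)"
proof -
  have "F (blinfun_power T j x) = blinfun_power T j (F x)" for j
    by (induction j) (simp_all add: blinfun_power_def assms)
  then show ?thesis
    by (simp add: cesaro_sum_def blinfun.sum_left blinfun.sum_right blinfun.scaleR_left blinfun.scaleR_right)
qed

lemma cesaro_sum_bound_plus1:
  assumes "\<And>n. norm (cesaro_sum a T n) \<le> M * cesaro_kernel (a + 1) n"
  shows "norm (cesaro_sum (a + 1) T n) \<le> M * cesaro_kernel (a + 1 + 1) n"
proof (induction n)
  case 0
  then show ?case using assms[of 0] by simp
next
  case (Suc n)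
  have "norm (cesaro_sum (a + 1) T (Suc n)) \<le> norm (cesaro_sum (a + 1) T n) + norm (cesaro_sum a T (Suc n))"
    unfolding cesaro_sum_plus1_Suc by (rule norm_triangle_ineq)
  also have "\<dots> \<le> M * cesaro_kernel (a + 1 + 1) n + M * cesaro_kernel (a + 1) (Suc n)"
    by (intro add_mono Suc assms)
  finally show ?case unfolding cesaro_kernel_plus1_Suc[of "a + 1"] distrib_left .
qed

section \<open>Weighted partial sums and the operator given by the functional calculus\<close>

locale cesaro_bounded_operator =
  fixes T :: "'a::cbanach \<Rightarrow>\<^sub>L 'a" and \<alpha> M :: real
  assumes \<alpha>: "\<alpha> \<ge> 0"
    and bound: "norm (cesaro_sum \<alpha> T n) \<le> M * cesaro_kernel (\<alpha> + 1) n"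
begin

definition A where "A = id_blinfun - T"

definition H where "H = cesaro_calculus \<alpha> (\<lambda>z. (1 - z) * Ln (1 - z)) T"

text \<open>The integral of the theorem, by \<open>weyl_inverse_0\<close>; as \<open>- g 0\<close>
  it fits the summation by parts at index 0.\<close>

definition C where "C = - weyl_inverse \<alpha> 0"

abbreviation S where "S \<equiv> cesaro_sum \<alpha> T"

abbreviation g where "g \<equiv> weyl_inverse \<alpha>"

definition L where "L N = (\<Sum>n=1..N. g n *\<^sub>R S n)"

text \<open>The Weyl differences of the Taylor coefficients of (1 - z) log(1 - z), hence the weights
  of \<open>S n\<close> in \<open>H\<close>; the value at 0 comes from
  \<open>weyl_difference_log_0\<close>.\<close>

definition d where
  "d n = (case n of 0 \<Rightarrow> (1 + \<alpha>) * C - \<alpha> | Suc m \<Rightarrow> g m - g (Suc m))"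

lemma A_apply: "A x = x - T x"
  by (simp add: A_def blinfun.diff_left)

lemma M_nonneg: "M \<ge> 0"
  using bound[of 0] norm_ge_zero[of "S 0"] by (simp del: norm_ge_zero)

lemma kernel_pos: "cesaro_kernel (\<alpha> + 1) n > 0"
  using \<alpha> by (intro cesaro_kernel_pos) simp

lemma kernel1_pos: "cesaro_kernel (\<alpha> + 1 + 1) n > 0"
  using \<alpha> by (intro cesaro_kernel_pos) simp

lemma g_eq: "n \<ge> 1 \<Longrightarrow> g n = 1 / (real n * cesaro_kernel (\<alpha> + 1) n)"
  by (rule weyl_inverse_eq[OF \<alpha>])

lemma g_pos: "n \<ge> 1 \<Longrightarrow> g n > 0"
  using kernel_pos[of n] by (simp add: g_eq)

lemma g_diff: "n \<ge> 1 \<Longrightarrow> g n - g (Suc n) = (\<alpha> + 1) / real n * g (Suc n)"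
  using weyl_inverse_Suc[OF \<alpha>, of n] by (simp add: field_simps)

text \<open>This matches the normalisation of the means of order \<open>\<alpha> + 1\<close>, so a
  second summation by parts produces the weights \<open>1 / n\<close>.\<close>

lemma g_diff_kernel:
  assumes "n \<ge> 1"
  shows "g n - g (Suc n) = 1 / (real n * cesaro_kernel (\<alpha> + 1 + 1) n)"
proof -
  have "g (Suc n) = 1 / ((\<alpha> + 1) * cesaro_kernel (\<alpha> + 1 + 1) n)"
    using g_eq[of "Suc n"] by (simp add: cesaro_kernel_rec del: of_nat_Suc)
  then show ?thesis unfolding g_diff[OF assms] using \<alpha> by simp
qed

lemma g_kernel:
  assumes "n \<ge> 1"
  shows "g n * cesaro_kernel \<alpha> (Suc n) = \<alpha> / real n - \<alpha> / real (Suc n)"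
proof -
  have "cesaro_kernel \<alpha> (Suc n) = \<alpha> * cesaro_kernel (\<alpha> + 1) n / real (Suc n)"
    using cesaro_kernel_rec[of n \<alpha>] by (simp add: field_simps)
  then show ?thesis
    using assms kernel_pos[of n] by (simp add: g_eq) (simp add: field_simps)
qed

lemma norm_g_S: "n \<ge> 1 \<Longrightarrow> norm (g n *\<^sub>R S n) \<le> M / real n"
  using mult_left_mono[OF bound[of n], of "g n"] g_pos[of n] kernel_pos[of n]
  by (simp add: g_eq field_simps)

text \<open>A difference of \<open>g\<close> gains a factor of order \<open>1 / n\<close>. The bound
  is written as a difference so that the tail beyond \<open>N\<close> sums to a multiple of
  \<open>1 / N\<close>.\<close>

lemma norm_d_S:
  assumes "n \<ge> 1"
  shows "norm (d (Suc n) *\<^sub>R S (Suc n)) \<le> (\<alpha> + 1) * M / real n - (\<alpha> + 1) * M / real (Suc n)"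
proof -
  have "norm (d (Suc n) *\<^sub>R S (Suc n)) = (\<alpha> + 1) / real n * norm (g (Suc n) *\<^sub>R S (Suc n))"
    using \<alpha> by (simp add: d_def g_diff[OF assms] abs_mult)
  also have "\<dots> \<le> (\<alpha> + 1) / real n * (M / real (Suc n))"
    using \<alpha> norm_g_S[of "Suc n"] by (intro mult_left_mono) auto
  also have "\<dots> = (\<alpha> + 1) * M / real n - (\<alpha> + 1) * M / real (Suc n)"
    using assms by (simp add: field_simps)
  finally show ?thesis .
qed

lemma d_S_tail_sums:
  assumes "N \<ge> 1"
  shows "(\<lambda>n. (\<alpha> + 1) * M / real (n + N) - (\<alpha> + 1) * M / real (Suc n + N)) sums ((\<alpha> + 1) * M / real N)"
proof -
  have "(\<lambda>n. (\<alpha> + 1) * M / real (n + N)) \<longlonglongrightarrow> 0"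
    by real_asymp
  from telescope_sums'[OF this] show ?thesis by simp
qed

lemma summable_norm_d_S: "summable (\<lambda>n. norm (d n *\<^sub>R S n))"
proof -
  have "summable (\<lambda>n. norm (d (n + 2) *\<^sub>R S (n + 2)))"
  proof (rule summable_comparison_test')
    show "summable (\<lambda>n. (\<alpha> + 1) * M / real (n + 1) - (\<alpha> + 1) * M / real (Suc n + 1))"
      using d_S_tail_sums[of 1] sums_summable by blast
    show "norm (norm (d (n + 2) *\<^sub>R S (n + 2))) \<le> (\<alpha> + 1) * M / real (n + 1) - (\<alpha> + 1) * M / real (Suc n + 1)"
      if "n \<ge> 0" for n
      using norm_d_S[of "Suc n"] by simp
  qed
  then show ?thesis by (subst (asm) summable_iff_shift)
qed

lemma H_eq: "H = (\<Sum>n. d n *\<^sub>R S n)"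
proof -
  have "weyl_difference \<alpha> (fps_nth (fps_expansion (\<lambda>z. (1 - z) * Ln (1 - z)) 0)) n = of_real (d n)" for n
    using weyl_difference_log_0[OF \<alpha>] weyl_difference_log_Suc[OF \<alpha>]
    by (cases n) (simp_all add: d_def C_def algebra_simps)
  then show ?thesis
    by (simp add: H_def cesaro_calculus_def scaleC_of_real)
qed

lemma H_sums: "(\<lambda>n. d n *\<^sub>R S n) sums H"
  unfolding H_eq by (rule summable_sums[OF summable_norm_cancel[OF summable_norm_d_S]])

lemma norm_H_tail:
  assumes "N \<ge> 1"
  shows "norm ((\<Sum>n\<le>N. d n *\<^sub>R S n) - H) \<le> (\<alpha> + 1) * M / real N"
proof -
  have "H = (\<Sum>n. d (n + Suc N) *\<^sub>R S (n + Suc N)) + (\<Sum>n\<le>N. d n *\<^sub>R S n)"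
    unfolding H_eq lessThan_Suc_atMost[symmetric]
    by (rule suminf_split_initial_segment[OF summable_norm_cancel[OF summable_norm_d_S]])
  then have "norm ((\<Sum>n\<le>N. d n *\<^sub>R S n) - H) = norm (\<Sum>n. d (n + Suc N) *\<^sub>R S (n + Suc N))"
    by (simp add: norm_minus_commute)
  also have "\<dots> \<le> (\<Sum>n. norm (d (n + Suc N) *\<^sub>R S (n + Suc N)))"
    using summable_norm_d_S by (intro summable_norm) (subst summable_iff_shift)
  also have "\<dots> \<le> (\<Sum>n. (\<alpha> + 1) * M / real (n + N) - (\<alpha> + 1) * M / real (Suc n + N))"
  proof (rule suminf_le)
    show "summable (\<lambda>n. norm (d (n + Suc N) *\<^sub>R S (n + Suc N)))"
      using summable_norm_d_S by (subst summable_iff_shift)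
    show "summable (\<lambda>n. (\<alpha> + 1) * M / real (n + N) - (\<alpha> + 1) * M / real (Suc n + N))"
      using d_S_tail_sums[OF assms] by (rule sums_summable)
    show "norm (d (n + Suc N) *\<^sub>R S (n + Suc N)) \<le> (\<alpha> + 1) * M / real (n + N) - (\<alpha> + 1) * M / real (Suc n + N)" for n
      using norm_d_S[of "n + N"] assms by simp
  qed
  also have "\<dots> = (\<alpha> + 1) * M / real N" using d_S_tail_sums[OF assms] by (rule sums_unique[symmetric])
  finally show ?thesis .
qed

text \<open>Summation by parts: for \<open>n \<ge> 1\<close> the recurrence
  \<open>cesaro_sum_Suc\<close> splits \<open>(g n - g (Suc n)) S (Suc n)\<close> into
  \<open>- A (g n S n)\<close>, a telescoping difference of \<open>g n S n\<close> and, by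
  \<open>g_kernel\<close>, a telescoping multiple of the identity.\<close>

lemma H_partial_sum:
  "(\<Sum>n\<le>Suc N. d n *\<^sub>R S n)
     = C *\<^sub>R A - (A o\<^sub>L L N) - g (Suc N) *\<^sub>R S (Suc N) - (\<alpha> / real (Suc N)) *\<^sub>R id_blinfun"
proof (induction N)
  \<comment> \<open>The first two coefficients supply the term \<open>C *\<^sub>R A\<close>, because
    \<open>g 0 = - C\<close>.\<close>
  case 0
  show ?case
  proof (rule blinfun_eqI)
    fix x
    have k: "cesaro_kernel \<alpha> (Suc 0) = \<alpha>" by (simp add: cesaro_kernel_def)
    show "(\<Sum>n\<le>Suc 0. d n *\<^sub>R S n) x
      = (C *\<^sub>R A - (A o\<^sub>L L 0) - g (Suc 0) *\<^sub>R S (Suc 0) - (\<alpha> / real (Suc 0)) *\<^sub>R id_blinfun) x"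
      by (simp add: d_def L_def cesaro_sum_Suc k blinfun.add_left blinfun.diff_left blinfun.scaleR_left
          blinfun.zero_left blinfun.zero_right blinfun.minus_left A_apply C_def algebra_simps)
  qed
next
  case (Suc N)
  show ?case
  proof (rule blinfun_eqI)
    fix x
    have *: "S (Suc (Suc N)) x = T (S (Suc N) x) + cesaro_kernel \<alpha> (Suc (Suc N)) *\<^sub>R x"
      by (simp add: cesaro_sum_Suc[of _ _ "Suc N"] blinfun.add_left blinfun.scaleR_left)
    have "g (Suc N) *\<^sub>R S (Suc (Suc N)) x = g (Suc N) *\<^sub>R T (S (Suc N) x)
        + (\<alpha> / real (Suc N) - \<alpha> / real (Suc (Suc N))) *\<^sub>R x"
      unfolding * using g_kernel[of "Suc N"] by (simp add: scaleR_add_right del: of_nat_Suc)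
    moreover have "A (L (Suc N) x) = A (L N x) + g (Suc N) *\<^sub>R (S (Suc N) x - T (S (Suc N) x))"
      by (simp add: L_def blinfun.add_left blinfun.add_right blinfun.scaleR_left blinfun.scaleR_right A_apply scaleR_diff_right)
    moreover have "(\<Sum>n\<le>Suc (Suc N). d n *\<^sub>R S n) x
       = (\<Sum>n\<le>Suc N. d n *\<^sub>R S n) x + (g (Suc N) - g (Suc (Suc N))) *\<^sub>R S (Suc (Suc N)) x"
      by (simp add: blinfun.add_left blinfun.scaleR_left d_def)
    ultimately show "(\<Sum>n\<le>Suc (Suc N). d n *\<^sub>R S n) x
      = (C *\<^sub>R A - (A o\<^sub>L L (Suc N)) - g (Suc (Suc N)) *\<^sub>R S (Suc (Suc N)) - (\<alpha> / real (Suc (Suc N))) *\<^sub>R id_blinfun) x"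
      unfolding Suc
      by (simp add: blinfun.add_left blinfun.diff_left blinfun.scaleR_left scaleR_diff_left scaleR_diff_right del: of_nat_Suc)
  qed
qed

lemma norm_remainder:
  "norm (C *\<^sub>R A - H - (A o\<^sub>L L N)) \<le> ((\<alpha> + 1) * M + M + \<alpha>) / real (Suc N)"
proof -
  have "C *\<^sub>R A - H - (A o\<^sub>L L N)
      = ((\<Sum>n\<le>Suc N. d n *\<^sub>R S n) - H) + g (Suc N) *\<^sub>R S (Suc N) + (\<alpha> / real (Suc N)) *\<^sub>R id_blinfun"
    unfolding H_partial_sum by (simp add: algebra_simps)
  also have "norm \<dots> \<le> (\<alpha> + 1) * M / real (Suc N) + M / real (Suc N) + \<alpha> / real (Suc N)"
  proof (intro norm_triangle_le add_mono)
    show "norm ((\<alpha> / real (Suc N)) *\<^sub>R (id_blinfun :: 'a \<Rightarrow>\<^sub>L 'a)) \<le> \<alpha> / real (Suc N)"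
      using \<alpha> norm_blinfun_id_le[where 'a = 'a]
        mult_left_mono[of "norm (id_blinfun :: 'a \<Rightarrow>\<^sub>L 'a)" 1 "\<alpha> / real (Suc N)"] by simp
  qed (use norm_H_tail[of "Suc N"] norm_g_S[of "Suc N"] in simp_all)
  finally show ?thesis by (simp add: add_divide_distrib)
qed

lemma AL_tendsto: "(\<lambda>N. A (L N x)) \<longlonglongrightarrow> C *\<^sub>R A x - H x"
proof -
  have "(\<lambda>N. C *\<^sub>R A x - H x - A (L N x)) \<longlonglongrightarrow> 0"
  proof (rule Lim_null_comparison)
    show "(\<lambda>N. ((\<alpha> + 1) * M + M + \<alpha>) / real (Suc N) * norm x) \<longlonglongrightarrow> 0"
      by real_asymp
    show "\<forall>\<^sub>F N in sequentially. norm (C *\<^sub>R A x - H x - A (L N x)) \<le> ((\<alpha> + 1) * M + M + \<alpha>) / real (Suc N) * norm x"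
      using norm_blinfun_apply_le[OF norm_remainder]
      by (auto simp: blinfun.diff_left blinfun.scaleR_left simp del: of_nat_Suc intro!: always_eventually)
  qed
  from tendsto_diff[OF tendsto_const this, of "C *\<^sub>R A x - H x"] show ?thesis by simp
qed

lemma H_commute:
  fixes F :: "'a \<Rightarrow>\<^sub>L 'a"
  assumes "\<And>x. F (T x) = T (F x)"
  shows "F (H x) = H (F x)"
proof -
  have lim: "(\<lambda>N. \<Sum>n<N. d n *\<^sub>R S n y) \<longlonglongrightarrow> H y" for y
    using bounded_linear.tendsto[OF blinfun.bounded_linear_left H_sums[unfolded sums_def], of y]
    by (simp add: blinfun.sum_left blinfun.scaleR_left)
  have "(\<lambda>N. F (\<Sum>n<N. d n *\<^sub>R S n x)) \<longlonglongrightarrow> F (H x)"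
    by (intro blinfun.tendsto tendsto_const lim)
  moreover have "F (\<Sum>n<N. d n *\<^sub>R S n x) = (\<Sum>n<N. d n *\<^sub>R S n (F x))" for N
    by (simp add: blinfun.sum_right blinfun.scaleR_right cesaro_sum_commute[OF assms])
  ultimately show ?thesis using lim[of "F x"] LIMSEQ_unique by auto
qed

text \<open>The means of order \<open>\<alpha> + 1\<close>; those of order \<open>\<alpha>\<close> need not tend strongly to zero.\<close>

definition \<sigma> where "\<sigma> n = (1 / cesaro_kernel (\<alpha> + 1 + 1) n) *\<^sub>R cesaro_sum (\<alpha> + 1) T n"

text \<open>The index \<open>n - 1\<close> makes \<open>one_minus_cesaro_sum_plus1\<close> end at
  \<open>n\<close>, which gives \<open>A_Q\<close>. Natural subtraction truncates, so that identity
  is claimed only for \<open>n \<ge> 1\<close>.\<close>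

definition Q where "Q n = (1 / cesaro_kernel (\<alpha> + 1 + 1) n) *\<^sub>R cesaro_sum (\<alpha> + 1 + 1) T (n - 1)"

text \<open>One constant for all bounds that \<open>log_series_tendsto\<close> asks for: the first
  summand serves \<open>norm_remainder\<close>, the second \<open>norm_A_\<sigma>\<close>.\<close>

definition B where "B = ((\<alpha> + 1) * M + M + \<alpha>) + (1 + M) * (\<alpha> + 1)"

lemma B_ge: "B \<ge> M" "B \<ge> (1 + M) * (\<alpha> + 1)"
proof -
  have "(\<alpha> + 1) * M \<ge> 0" "(1 + M) * (\<alpha> + 1) \<ge> 0" using M_nonneg \<alpha> by auto
  then show "B \<ge> M" "B \<ge> (1 + M) * (\<alpha> + 1)" using M_nonneg \<alpha> unfolding B_def by linarith+
qed

lemma A_Q: "n \<ge> 1 \<Longrightarrow> A (Q n x) = x - \<sigma> n x"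
  using one_minus_cesaro_sum_plus1[of "\<alpha> + 1" T "n - 1" x] kernel1_pos[of n]
  by (simp add: A_apply Q_def \<sigma>_def blinfun.scaleR_left blinfun.scaleR_right flip: scaleR_diff_right)
    (simp add: scaleR_diff_right)

lemma T_commute: "T (cesaro_sum a T n x) = cesaro_sum a T n (T x)"
  by (rule cesaro_sum_commute) simp

lemma A_commute: "A (\<sigma> n x) = \<sigma> n (A x)" "A (Q n x) = Q n (A x)"
  by (simp_all add: A_apply \<sigma>_def Q_def blinfun.scaleR_left blinfun.scaleR_right blinfun.diff_right T_commute
      scaleR_diff_right)

lemma H_Q_commute: "H (Q n x) = Q n (H x)"
  by (rule H_commute[symmetric]) (simp add: Q_def blinfun.scaleR_left blinfun.scaleR_right T_commute)

lemma norm_\<sigma>: "norm (\<sigma> n) \<le> M"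
  using cesaro_sum_bound_plus1[OF bound, of n] kernel1_pos[of n]
  by (simp add: \<sigma>_def field_simps)

text \<open>The linear growth comes from \<open>cesaro_kernel_rec\<close>: the kernel of order
  \<open>\<alpha> + 3\<close> at \<open>n - 1\<close> is \<open>n / (\<alpha> + 2)\<close> times the
  one of order \<open>\<alpha> + 2\<close> at \<open>n\<close>.\<close>

lemma norm_Q:
  assumes "n \<ge> 1"
  shows "norm (Q n) \<le> M * real n"
proof -
  obtain m where n: "n = Suc m" using assms by (cases n) auto
  have "norm (cesaro_sum (\<alpha> + 1 + 1) T m) \<le> M * cesaro_kernel (\<alpha> + 1 + 1 + 1) m"
    by (rule cesaro_sum_bound_plus1[OF cesaro_sum_bound_plus1[OF bound]])
  also have "\<dots> \<le> M * (real n * cesaro_kernel (\<alpha> + 1 + 1) n)"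
  proof (rule mult_left_mono[OF _ M_nonneg])
    have "real n * cesaro_kernel (\<alpha> + 1 + 1) n = (\<alpha> + 1 + 1) * cesaro_kernel (\<alpha> + 1 + 1 + 1) m"
      unfolding n by (rule cesaro_kernel_rec)
    moreover have "cesaro_kernel (\<alpha> + 1 + 1 + 1) m > 0" using \<alpha> by (intro cesaro_kernel_pos) simp
    ultimately show "cesaro_kernel (\<alpha> + 1 + 1 + 1) m \<le> real n * cesaro_kernel (\<alpha> + 1 + 1) n"
      using \<alpha> by simp
  qed
  finally show ?thesis using kernel1_pos[of n] by (simp add: Q_def n field_simps del: of_nat_Suc)
qed

lemma norm_A_cesaro_sum1:
  "norm (A o\<^sub>L cesaro_sum (\<alpha> + 1) T n) \<le> (1 + M) * cesaro_kernel (\<alpha> + 1) (Suc n)"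
proof -
  have "(A o\<^sub>L cesaro_sum (\<alpha> + 1) T n) = cesaro_kernel (\<alpha> + 1) (Suc n) *\<^sub>R id_blinfun - S (Suc n)"
    by (rule blinfun_eqI) (simp add: A_apply one_minus_cesaro_sum_plus1 blinfun.diff_left blinfun.scaleR_left)
  also have "norm \<dots> \<le> cesaro_kernel (\<alpha> + 1) (Suc n) * 1 + M * cesaro_kernel (\<alpha> + 1) (Suc n)"
  proof (rule order_trans[OF norm_triangle_ineq4 add_mono[OF _ bound]])
    show "norm (cesaro_kernel (\<alpha> + 1) (Suc n) *\<^sub>R (id_blinfun :: 'a \<Rightarrow>\<^sub>L 'a)) \<le> cesaro_kernel (\<alpha> + 1) (Suc n) * 1"
      using norm_blinfun_id_le[where 'a = 'a] kernel_pos[of "Suc n"] by simp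
  qed
  finally show ?thesis by (simp add: algebra_simps)
qed

lemma norm_A_\<sigma>:
  assumes "n \<ge> 1"
  shows "norm (A o\<^sub>L \<sigma> n) \<le> B / real n"
proof -
  have "(A o\<^sub>L \<sigma> n) = (1 / cesaro_kernel (\<alpha> + 1 + 1) n) *\<^sub>R (A o\<^sub>L cesaro_sum (\<alpha> + 1) T n)"
    by (rule blinfun_eqI) (simp add: \<sigma>_def blinfun.scaleR_left blinfun.scaleR_right)
  then have "norm (A o\<^sub>L \<sigma> n) \<le> (1 + M) * cesaro_kernel (\<alpha> + 1) (Suc n) / cesaro_kernel (\<alpha> + 1 + 1) n"
    using norm_A_cesaro_sum1[of n] kernel1_pos[of n] by (simp add: divide_right_mono)
  also have "\<dots> = (1 + M) * (\<alpha> + 1) / real (Suc n)"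
    using cesaro_kernel_rec[of n "\<alpha> + 1"] kernel1_pos[of n] by (simp add: field_simps)
  also have "\<dots> \<le> B / real n"
    using B_ge M_nonneg \<alpha> assms by (intro frac_le) auto
  finally show ?thesis .
qed

text \<open>Second summation by parts: \<open>S n\<close> is a difference of consecutive sums of
  order \<open>\<alpha> + 1\<close>, so the differences of \<open>g\<close> fall on the means. The
  lower boundary term carries the weight \<open>g 1 = 1 / (\<alpha> + 1)\<close>.\<close>

lemma L_Suc_eq:
  "L (Suc N) = (\<Sum>j=1..N. (1 / real j) *\<^sub>R \<sigma> j) + g (Suc N) *\<^sub>R cesaro_sum (\<alpha> + 1) T (Suc N)
     - (1 / (\<alpha> + 1)) *\<^sub>R id_blinfun"
proof (induction N)
  case 0
  then show ?case
    using weyl_inverse_1[OF \<alpha>] by (simp add: L_def cesaro_sum_plus1_Suc scaleR_add_right)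
next
  case (Suc N)
  have "(1 / real (Suc N)) *\<^sub>R \<sigma> (Suc N) = (g (Suc N) - g (Suc (Suc N))) *\<^sub>R cesaro_sum (\<alpha> + 1) T (Suc N)"
    unfolding \<sigma>_def by (subst g_diff_kernel) auto
  moreover have "S (Suc (Suc N)) = cesaro_sum (\<alpha> + 1) T (Suc (Suc N)) - cesaro_sum (\<alpha> + 1) T (Suc N)"
    by (simp add: cesaro_sum_plus1_Suc)
  moreover have "L (Suc (Suc N)) = L (Suc N) + g (Suc (Suc N)) *\<^sub>R S (Suc (Suc N))"
    by (simp add: L_def)
  ultimately show ?case
    by (simp add: Suc scaleR_diff_left scaleR_diff_right del: of_nat_Suc)
qed

text \<open>Passing to the means adds \<open>1 / (\<alpha> + 1)\<close> to \<open>C\<close> and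
  leaves the upper boundary term, which is \<open>O(1/N)\<close> once \<open>A\<close> is applied to
  it.\<close>

lemma norm_remainder1:
  assumes "N \<ge> 1"
  shows "norm ((C + 1 / (\<alpha> + 1)) *\<^sub>R A - H - (A o\<^sub>L (\<Sum>j=1..N. (1 / real j) *\<^sub>R \<sigma> j))) \<le> B / real N"
proof -
  have "(C + 1 / (\<alpha> + 1)) *\<^sub>R A - H - (A o\<^sub>L (\<Sum>j=1..N. (1 / real j) *\<^sub>R \<sigma> j))
      = (C *\<^sub>R A - H - (A o\<^sub>L L (Suc N))) + g (Suc N) *\<^sub>R (A o\<^sub>L cesaro_sum (\<alpha> + 1) T (Suc N))"
    unfolding L_Suc_eq
    by (rule blinfun_eqI) (simp add: blinfun.add_left blinfun.diff_left blinfun.scaleR_left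
        blinfun.add_right blinfun.diff_right blinfun.scaleR_right scaleR_add_left)
  also have "norm \<dots> \<le> ((\<alpha> + 1) * M + M + \<alpha>) / real N + (1 + M) * (\<alpha> + 1) / real N"
  proof (intro norm_triangle_le add_mono)
    have "norm (C *\<^sub>R A - H - (A o\<^sub>L L (Suc N))) \<le> ((\<alpha> + 1) * M + M + \<alpha>) / real (Suc (Suc N))"
      by (rule norm_remainder)
    also have "\<dots> \<le> ((\<alpha> + 1) * M + M + \<alpha>) / real N"
      using assms \<alpha> M_nonneg by (intro frac_le) auto
    finally show "norm (C *\<^sub>R A - H - (A o\<^sub>L L (Suc N))) \<le> ((\<alpha> + 1) * M + M + \<alpha>) / real N" .
    have "g (Suc N) * cesaro_kernel (\<alpha> + 1) (Suc (Suc N)) = (\<alpha> + 1 + real (Suc N)) / (real (Suc (Suc N)) * real (Suc N))"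
      using cesaro_kernel_Suc[of "Suc N" "\<alpha> + 1"] kernel_pos[of "Suc N"]
      by (simp add: g_eq divide_simps mult_ac del: of_nat_Suc)
    also have "\<dots> = ((\<alpha> + 1 + real (Suc N)) / real (Suc (Suc N))) / real (Suc N)" by simp
    also have "\<dots> \<le> (\<alpha> + 1) / real N"
      using \<alpha> assms by (intro frac_le) (auto simp: field_simps)
    finally have g: "g (Suc N) * cesaro_kernel (\<alpha> + 1) (Suc (Suc N)) \<le> (\<alpha> + 1) / real N" .
    have "norm (g (Suc N) *\<^sub>R (A o\<^sub>L cesaro_sum (\<alpha> + 1) T (Suc N)))
        \<le> g (Suc N) * ((1 + M) * cesaro_kernel (\<alpha> + 1) (Suc (Suc N)))"
      using norm_A_cesaro_sum1[of "Suc N"] g_pos[of "Suc N"] by simp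
    also have "\<dots> \<le> (1 + M) * ((\<alpha> + 1) / real N)"
      using mult_left_mono[OF g, of "1 + M"] M_nonneg by (simp add: mult_ac)
    finally show "norm (g (Suc N) *\<^sub>R (A o\<^sub>L cesaro_sum (\<alpha> + 1) T (Suc N))) \<le> (1 + M) * (\<alpha> + 1) / real N"
      by simp
  qed
  finally show ?thesis by (simp add: B_def add_divide_distrib)
qed

section \<open>Consequences of dense range\<close>

context
  assumes dense: "closure (range (blinfun_apply A)) = UNIV"
begin

lemma \<sigma>_tendsto_0: "(\<lambda>n. \<sigma> n x) \<longlonglongrightarrow> 0"
proof (rule cesaro_means_tendsto_zero[OF dense A_commute(1) _ norm_A_\<sigma>])
  show "norm (\<sigma> n) \<le> B" for n using norm_\<sigma>[of n] B_ge(1) by linarith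
qed

text \<open>A vector annihilated by \<open>A\<close> is fixed by every \<open>\<sigma> n\<close>
  with \<open>n \<ge> 1\<close>, since \<open>A\<close> and \<open>Q n\<close> commute, while the
  means tend to zero.\<close>

lemma inj_A: "inj A"
proof (rule injI)
  fix x y assume "A x = A y"
  then have "A (x - y) = 0" by (simp add: blinfun.diff_right)
  then have "\<sigma> n (x - y) = x - y" if "n \<ge> 1" for n
    using A_Q[OF that, of "x - y"] A_commute(2)[of n "x - y"] by (simp add: blinfun.zero_right)
  then have "(\<lambda>n. \<sigma> n (x - y)) \<longlonglongrightarrow> x - y"
    by (intro tendsto_eventually) (auto simp: eventually_sequentially)
  from LIMSEQ_unique[OF this \<sigma>_tendsto_0] show "x = y" by simp
qed

text \<open>This boundary term of \<open>L_Suc_eq\<close> is \<open>\<sigma> n x\<close> times the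
  bounded factor \<open>1 / n + 1 / (\<alpha> + 1)\<close>.\<close>

lemma g_cesaro_sum1_tendsto_0: "(\<lambda>n. g n *\<^sub>R cesaro_sum (\<alpha> + 1) T n x) \<longlonglongrightarrow> 0"
proof (rule Lim_null_comparison)
  show "(\<lambda>n. 2 * norm (\<sigma> n x)) \<longlonglongrightarrow> 0"
    using tendsto_mult[OF tendsto_const tendsto_norm[OF \<sigma>_tendsto_0], of 2] by simp
  show "\<forall>\<^sub>F n in sequentially. norm (g n *\<^sub>R cesaro_sum (\<alpha> + 1) T n x) \<le> 2 * norm (\<sigma> n x)"
    using eventually_ge_at_top[of 1]
  proof eventually_elim
    case (elim n)
    have eq: "g n * cesaro_kernel (\<alpha> + 1 + 1) n = 1 / real n + 1 / (\<alpha> + 1)"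
    proof -
      have "(\<alpha> + 1) * cesaro_kernel (\<alpha> + 1 + 1) n = (\<alpha> + 1 + real n) * cesaro_kernel (\<alpha> + 1) n"
        using cesaro_kernel_rec[of n "\<alpha> + 1"] cesaro_kernel_Suc[of n "\<alpha> + 1"] by simp
      then have "cesaro_kernel (\<alpha> + 1 + 1) n = (\<alpha> + 1 + real n) * cesaro_kernel (\<alpha> + 1) n / (\<alpha> + 1)"
        using \<alpha> by (simp add: eq_divide_eq mult.commute)
      then have "g n * cesaro_kernel (\<alpha> + 1 + 1) n = (\<alpha> + 1 + real n) / (real n * (\<alpha> + 1))"
        using elim kernel_pos[of n] by (simp add: g_eq)
      also have "\<dots> = 1 / real n + 1 / (\<alpha> + 1)" using elim \<alpha> by (simp add: add_divide_eq_iff divide_add_eq_iff)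
      finally show ?thesis .
    qed
    also have "\<dots> \<le> 1 + 1"
      using elim \<alpha> by (intro add_mono) auto
    finally have "g n * cesaro_kernel (\<alpha> + 1 + 1) n \<le> 2" by simp
    moreover have "g n *\<^sub>R cesaro_sum (\<alpha> + 1) T n x = (g n * cesaro_kernel (\<alpha> + 1 + 1) n) *\<^sub>R \<sigma> n x"
      using kernel1_pos[of n] by (simp add: \<sigma>_def blinfun.scaleR_left)
    moreover have "g n * cesaro_kernel (\<alpha> + 1 + 1) n \<ge> 0"
      using g_pos[of n] elim kernel1_pos[of n] by simp
    ultimately show ?case by (simp only: norm_scaleR) (simp add: mult_right_mono)
  qed
qed

text \<open>The limit for the means is transported by \<open>L_Suc_eq\<close>: the boundary term
  vanishes, and the identity term takes back the \<open>1 / (\<alpha> + 1)\<close> added to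
  \<open>C\<close>.\<close>

lemma L_tendsto:
  assumes "H x = A w"
  shows "(\<lambda>N. L N x) \<longlonglongrightarrow> C *\<^sub>R x - w"
proof (rule LIMSEQ_imp_Suc)
  have "(\<lambda>N. (\<Sum>j=1..N. (1 / real j) *\<^sub>R \<sigma> j) x) \<longlonglongrightarrow> (C + 1 / (\<alpha> + 1)) *\<^sub>R x - w"
  proof (rule log_series_tendsto[OF dense A_Q A_commute H_Q_commute _ _ norm_A_\<sigma> norm_remainder1 assms])
    show "norm (\<sigma> n) \<le> B" for n using norm_\<sigma>[of n] B_ge(1) by linarith
    show "norm (Q n) \<le> B * real n" if "n \<ge> 1" for n
      using norm_Q[OF that] mult_right_mono[OF B_ge(1), of "real n"] by linarith
  qed
  moreover note LIMSEQ_Suc[OF g_cesaro_sum1_tendsto_0, of x]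
  ultimately have "(\<lambda>N. (\<Sum>j=1..N. (1 / real j) *\<^sub>R \<sigma> j) x + g (Suc N) *\<^sub>R cesaro_sum (\<alpha> + 1) T (Suc N) x
      - (1 / (\<alpha> + 1)) *\<^sub>R x) \<longlonglongrightarrow> (C + 1 / (\<alpha> + 1)) *\<^sub>R x - w + 0 - (1 / (\<alpha> + 1)) *\<^sub>R x"
    by (intro tendsto_intros)
  then show "(\<lambda>N. L (Suc N) x) \<longlonglongrightarrow> C *\<^sub>R x - w"
    unfolding L_Suc_eq
    by (simp add: blinfun.add_left blinfun.diff_left blinfun.scaleR_left scaleR_add_left)
qed

end

text \<open>The quotient of the two weights is \<open>l + O(1/n)\<close> and \<open>g n S n\<close>
  is \<open>O(1/n)\<close>, so the terms of the difference are \<open>O(1/n^2)\<close>. Norm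
  convergence of the difference lets both strong and weak convergence transfer.\<close>

lemma L_comparison:
  obtains l where "l > 0"
    "convergent (\<lambda>N. (\<Sum>n=1..N. (1 / real n powr (1 + \<alpha>)) *\<^sub>R S n x) - l *\<^sub>R L N x)"
proof -
  obtain l c where l: "l > 0"
    and c: "\<And>n. n \<ge> 1 \<Longrightarrow> \<bar>cesaro_kernel (\<alpha> + 1) n / real n powr \<alpha> - l\<bar> \<le> c / real n"
    using cesaro_kernel_asymptotics[OF \<alpha>] by blast
  define e where "e n = (1 / real n powr (1 + \<alpha>) - l * g n) *\<^sub>R S n x" for n
  have e: "norm (e n) \<le> c * M * norm x * (1 / real n ^ 2)" if n: "n \<ge> 1" for n
  proof -
    have "1 / real n powr (1 + \<alpha>) - l * g n = (cesaro_kernel (\<alpha> + 1) n / real n powr \<alpha> - l) * g n"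
      using n kernel_pos[of n] by (simp add: g_eq powr_add field_simps)
    then have "norm (e n) = \<bar>cesaro_kernel (\<alpha> + 1) n / real n powr \<alpha> - l\<bar> * norm ((g n *\<^sub>R S n) x)"
      by (simp add: e_def abs_mult blinfun.scaleR_left)
    also have "\<dots> \<le> (c / real n) * (M / real n * norm x)"
      using c[OF n] norm_blinfun_apply_le[OF norm_g_S[OF n], of x] by (intro mult_mono) auto
    finally show ?thesis by (simp add: power2_eq_square)
  qed
  have "summable (\<lambda>n. c * M * norm x * (1 / real n ^ 2))"
    by (intro summable_mult inverse_power_summable[of 2, where 'a = real, unfolded inverse_eq_divide]) simp
  then have "summable e"
    by (rule summable_comparison_test') (rule e)
  then have "convergent (\<lambda>N. \<Sum>n\<le>N. e n)" by (simp add: summable_iff_convergent')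
  moreover have "(\<Sum>n=1..N. (1 / real n powr (1 + \<alpha>)) *\<^sub>R S n x) - l *\<^sub>R L N x = (\<Sum>n\<le>N. e n) - e 0" for N
  proof -
    have "(\<Sum>n=1..N. (1 / real n powr (1 + \<alpha>)) *\<^sub>R S n x) - l *\<^sub>R L N x = (\<Sum>n=1..N. e n)"
      by (simp add: L_def e_def blinfun.sum_left blinfun.scaleR_left scaleR_sum_right scaleR_diff_left sum_subtractf)
    moreover have "(\<Sum>n\<le>N. e n) = e 0 + (\<Sum>n=1..N. e n)"
      by (simp add: atMost_atLeast0 sum.atLeast_Suc_atMost)
    ultimately show ?thesis by simp
  qed
  ultimately show ?thesis
    using that[OF l] by (simp add: convergent_diff_const_right_iff)
qed

text \<open>As \<open>T\<close> is complex-linear, \<open>\<phi> o\<^sub>L A\<close> is again a test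
  functional, so \<open>A (L N x)\<close> tends weakly to \<open>A y\<close>. It also has the norm
  limit from \<open>AL_tendsto\<close>, and functionals separate points.\<close>

lemma weak_limit_imp:
  assumes T: "clinear T"
    and lim: "\<And>\<phi> :: 'a \<Rightarrow>\<^sub>L complex. clinear \<phi> \<Longrightarrow> (\<lambda>N. \<phi> (L N x)) \<longlonglongrightarrow> \<phi> y"
  shows "H x = A (C *\<^sub>R x - y)"
proof (rule ccontr)
  assume "H x \<noteq> A (C *\<^sub>R x - y)"
  then have "A y - (C *\<^sub>R A x - H x) \<noteq> 0"
    by (simp add: blinfun.diff_right blinfun.scaleR_right algebra_simps)
  then obtain \<phi> :: "'a \<Rightarrow>\<^sub>L complex" where \<phi>: "clinear \<phi>" "\<phi> (A y - (C *\<^sub>R A x - H x)) \<noteq> 0"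
    by (rule clinear_functional_nonzero)
  have "A (c *\<^sub>C z) = c *\<^sub>C A z" for c z
    using T linear_diff[OF bounded_linear.linear[OF bounded_linear_scaleC[of c]], of z "T z"]
    by (simp add: A_apply clinear_iff)
  then have "clinear (\<phi> o\<^sub>L A)"
    using \<phi>(1) by (simp add: clinear_iff blinfun.add_right)
  from lim[OF this] have "(\<lambda>N. \<phi> (A (L N x))) \<longlonglongrightarrow> \<phi> (A y)" by simp
  moreover have "(\<lambda>N. \<phi> (A (L N x))) \<longlonglongrightarrow> \<phi> (C *\<^sub>R A x - H x)"
    by (intro blinfun.tendsto tendsto_const AL_tendsto)
  ultimately have "\<phi> (A y) = \<phi> (C *\<^sub>R A x - H x)" by (rule LIMSEQ_unique)
  then show False
    using \<phi>(2) blinfun.diff_right[of \<phi> "A y"] by simp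
qed

end

theorem theorem5:
  fixes T :: "'a::cbanach \<Rightarrow>\<^sub>L 'a" and \<alpha> :: real and x :: 'a
  assumes "\<alpha> \<ge> 0"
    and "clinear T"
    and "cesaro_bounded \<alpha> T"
    and "closure (range (id_blinfun - T)) = UNIV"
  shows "(x \<in> log_domain \<alpha> T \<longleftrightarrow>
            convergent (\<lambda>N. \<Sum>n=1..N. (1 / real n powr (1 + \<alpha>)) *\<^sub>R cesaro_sum \<alpha> T n x))
       \<and> (convergent (\<lambda>N. \<Sum>n=1..N. (1 / real n powr (1 + \<alpha>)) *\<^sub>R cesaro_sum \<alpha> T n x) \<longleftrightarrow>
            weakly_convergent (\<lambda>N. \<Sum>n=1..N. (1 / real n powr (1 + \<alpha>)) *\<^sub>R cesaro_sum \<alpha> T n x))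
       \<and> (x \<in> log_domain \<alpha> T \<or>
            convergent (\<lambda>N. \<Sum>n=1..N. (1 / real n powr (1 + \<alpha>)) *\<^sub>R cesaro_sum \<alpha> T n x) \<longrightarrow>
          summable (\<lambda>n.
            (Gamma (\<alpha> + 1) * Gamma (real (Suc n)) / Gamma (real (Suc n) + \<alpha> + 1)) *\<^sub>R cesaro_sum \<alpha> T (Suc n) x)
          \<and> log_op \<alpha> T x =
              integral {0..1} (\<lambda>u. (1 - u powr \<alpha>) / (1 - u)) *\<^sub>R x
              - (\<Sum>n.
                  (Gamma (\<alpha> + 1) * Gamma (real (Suc n)) / Gamma (real (Suc n) + \<alpha> + 1)) *\<^sub>R cesaro_sum \<alpha> T (Suc n) x))"
proof -
  obtain M where M: "\<And>n. norm (cesaro_sum \<alpha> T n) / cesaro_kernel (\<alpha> + 1) n \<le> M"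
    using assms(3) unfolding cesaro_bounded_def bdd_above_def by auto
  interpret cesaro_bounded_operator T \<alpha> M
  proof
    show "norm (cesaro_sum \<alpha> T n) \<le> M * cesaro_kernel (\<alpha> + 1) n" for n
      using M[of n] cesaro_kernel_pos[of "\<alpha> + 1" n] assms(1) by (simp add: field_simps)
  qed (rule assms(1))
  define X where "X N = (\<Sum>n=1..N. (1 / real n powr (1 + \<alpha>)) *\<^sub>R S n x)" for N
  have dense: "closure (range A) = UNIV" using assms(4) by (simp add: A_def)
  obtain l where l: "l > 0" and conv: "convergent (\<lambda>N. X N - l *\<^sub>R L N x)"
    by (rule L_comparison[of x]) (auto simp: X_def)
  from conv obtain z where z: "(\<lambda>N. X N - l *\<^sub>R L N x) \<longlonglongrightarrow> z"
    by (auto simp: convergent_def)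
  have dom: "x \<in> log_domain \<alpha> T \<longleftrightarrow> (\<exists>w. H x = A w)"
    by (auto simp: log_domain_def H_def A_def)
  have strong: "convergent X" if "H x = A w" for w
  proof -
    have "(\<lambda>N. (X N - l *\<^sub>R L N x) + l *\<^sub>R L N x) \<longlonglongrightarrow> z + l *\<^sub>R (C *\<^sub>R x - w)"
      by (intro tendsto_intros z L_tendsto[OF dense that])
    then show ?thesis by (auto simp: convergent_def)
  qed
  have weak: "weakly_convergent X" if "convergent X"
  proof -
    obtain \<xi> where "X \<longlonglongrightarrow> \<xi>" using \<open>convergent X\<close> by (auto simp: convergent_def)
    then show ?thesis
      unfolding weakly_convergent_def by (intro exI[of _ \<xi>]) (auto intro!: blinfun.tendsto tendsto_const)
  qed
  have dom_weak: "\<exists>w. H x = A w" if "weakly_convergent X"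
  proof -
    obtain \<xi> where \<xi>: "\<And>\<phi> :: 'a \<Rightarrow>\<^sub>L complex. clinear \<phi> \<Longrightarrow> (\<lambda>N. \<phi> (X N)) \<longlonglongrightarrow> \<phi> \<xi>"
      using \<open>weakly_convergent X\<close> by (auto simp: weakly_convergent_def)
    \<comment> \<open>Removing the norm convergent difference from \<open>X\<close> and dividing by
      \<open>l\<close> gives a weak limit of \<open>L N x\<close>.\<close>
    have "(\<lambda>N. \<phi> (L N x)) \<longlonglongrightarrow> \<phi> ((1 / l) *\<^sub>R (\<xi> - z))" if "clinear \<phi>" for \<phi> :: "'a \<Rightarrow>\<^sub>L complex"
    proof -
      have "(\<lambda>N. (1 / l) *\<^sub>R (\<phi> (X N) - \<phi> (X N - l *\<^sub>R L N x))) \<longlonglongrightarrow> (1 / l) *\<^sub>R (\<phi> \<xi> - \<phi> z)"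
        by (intro tendsto_intros \<xi>[OF that] z)
      then show ?thesis
        using l by (simp add: blinfun.diff_right blinfun.scaleR_right)
    qed
    from weak_limit_imp[OF assms(2) this] show ?thesis by blast
  qed
  have formula: "summable (\<lambda>n. (Gamma (\<alpha> + 1) * Gamma (real (Suc n)) / Gamma (real (Suc n) + \<alpha> + 1)) *\<^sub>R S (Suc n) x)
      \<and> log_op \<alpha> T x = integral {0..1} (\<lambda>u. (1 - u powr \<alpha>) / (1 - u)) *\<^sub>R x
        - (\<Sum>n. (Gamma (\<alpha> + 1) * Gamma (real (Suc n)) / Gamma (real (Suc n) + \<alpha> + 1)) *\<^sub>R S (Suc n) x)"
    if w: "H x = A w" for w
  proof -
    have "L N x = (\<Sum>n<N. (Gamma (\<alpha> + 1) * Gamma (real (Suc n)) / Gamma (real (Suc n) + \<alpha> + 1)) *\<^sub>R S (Suc n) x)" for N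
      by (simp add: L_def sum.atLeast1_atMost_eq blinfun.sum_left blinfun.scaleR_left weyl_inverse_Gamma[OF assms(1)]
          del: of_nat_Suc)
    then have "(\<lambda>n. (Gamma (\<alpha> + 1) * Gamma (real (Suc n)) / Gamma (real (Suc n) + \<alpha> + 1)) *\<^sub>R S (Suc n) x)
        sums (C *\<^sub>R x - w)"
      using L_tendsto[OF dense w] by (simp only: sums_def)
    \<comment> \<open>Injectivity of \<open>A\<close> ensures that \<open>inv\<close> returns this
      preimage and not some other choice.\<close>
    moreover have "log_op \<alpha> T x = w"
      using inv_f_f[OF inj_A[OF dense], of w] w by (simp add: log_op_def H_def A_def)
    moreover have "C = integral {0..1} (\<lambda>u. (1 - u powr \<alpha>) / (1 - u))"
      by (simp add: C_def weyl_inverse_0[OF assms(1)])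
    ultimately show ?thesis by (simp add: sums_iff)
  qed
  \<comment> \<open>A cycle: domain, norm convergence, weak convergence, domain.\<close>
  have iff: "(\<exists>w. H x = A w) \<longleftrightarrow> convergent X" "convergent X \<longleftrightarrow> weakly_convergent X"
    using strong weak dom_weak by blast+
  show ?thesis
    unfolding X_def[symmetric] dom
  proof (intro conjI impI)
    show "(\<exists>w. H x = A w) = convergent X" "convergent X = weakly_convergent X" by (fact iff)+
    assume "(\<exists>w. H x = A w) \<or> convergent X"
    then obtain w where w: "H x = A w" using iff(1) by blast
    show "summable (\<lambda>n. (Gamma (\<alpha> + 1) * Gamma (real (Suc n)) / Gamma (real (Suc n) + \<alpha> + 1)) *\<^sub>R S (Suc n) x)"
      and "log_op \<alpha> T x = integral {0..1} (\<lambda>u. (1 - u powr \<alpha>) / (1 - u)) *\<^sub>R x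
        - (\<Sum>n. (Gamma (\<alpha> + 1) * Gamma (real (Suc n)) / Gamma (real (Suc n) + \<alpha> + 1)) *\<^sub>R S (Suc n) x)"
      using formula[OF w] by simp_all
  qed
qed

end
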